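(* The problem MCCEnum, with input an implicational base $\Sigma$ over $X$ with associated closure system $\mathcal{F}$ and a consistency-graph $G_c = (X, E_c)$, can be solved in incremental-polynomial time in each of the following cases (i.e. when inputs are restricted to those satisfying the given condition): (1) $\mathcal{F}$ is distributive; (2) $\mathcal{F}$ is the family of convex subsets of a poset on $X$; (3) $\mathcal{F}$ is the family of monophonically convex subsets of a chordal graph on $X$; (4) $\mathcal{F}$ is an affine convex geometry in $\mathbb{R}^k$, for a fixed constant $k$.
   Context: All objects are finite. An implication over a set $X$ is an expression $A \to B$ with $A, B \subseteq X$. An implicational base $\Sigma$ over $X$ is a set of implications over $X$. A set $F \subseteq X$ satisfies $\Sigma$ if for every $A \to B \in \Sigma$, $A \subseteq F$ implies $B \subseteq F$. The family $\mathcal{F}$ of all subsets of $X$ satisfying $\Sigma$ is the closure system associated to $\Sigma$; its members are called closed sets. A consistency-graph over $X$ is a (simple, undirected) graph $G_c = (X, E_c)$; it is non-empty if $E_c \neq \emptyset$. The set $\mathsf{maxCC}(\Sigma, G_c)$ consists of the inclusion-wise maximal members of $\{F \in \mathcal{F} \mid F \text{ is an independent set of } G_c\}$. Problem MCCEnum. Input: an implicational base $\Sigma$ over $X$ (with $X$ part of the input) and a non-empty consistency-graph $G_c = (X, E_c)$. Output: the set $\mathsf{maxCC}(\Sigma, G_c)$. An enumeration algorithm with input $x$ and set of solutions $R(x)$ runs in incremental-polynomial time if for every $1 \leq i \leq |R(x)|$ the time spent between the $i$-th and $(i+1)$-th output is bounded by a polynomial in $|x| + i$, and the algorithm stops in time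 polynomial in $|x|$ after the last output. $\mathcal{F}$ is distributive if $F_1 \cup F_2 \in \mathcal{F}$ for all $F_1, F_2 \in \mathcal{F}$. A subset $Y$ of a poset $(X, \leq)$ is convex if $x \leq y \leq z$ and $x, z \in Y$ imply $y \in Y$. A graph is chordal if it has no induced cycle of size at least $4$. A chord of a path is an edge connecting two non-adjacent vertices of the path; a subset $Y$ of the vertex set $X$ of a graph is monophonically convex if for all $x, y \in Y$, every vertex lying on a chordless path from $x$ to $y$ belongs to $Y$. For a finite set of points $X \subseteq \mathbb{R}^k$, the affine convex geometry on $X$ is the closure system $\{\mathrm{ch}(Y) \cap X \mid Y \subseteq X\}$, where $\mathrm{ch}(Y)$ is the convex hull of $Y$. *)

theory Defs
  imports "HOL-Analysis.Analysis" "HOL-Computational_Algebra.Polynomial"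
begin

text \<open>
  Time is measured in a WHILE language over binary trees (in the style of Jones, ``Computability
  and Complexity from a Programming Perspective''), made sensitive to the size of the data: the
  evaluation of every subexpression is charged the number of nodes of its value (plus one), also
  when it merely reads a variable.  Hence no operation handles more data than it is charged for,
  and the model and multi-tape Turing machines simulate each other with polynomial overhead.
\<close>

datatype data = Leaf | Branch data data

primrec nodes :: "data \<Rightarrow> nat" where
  "nodes Leaf = 1"
| "nodes (Branch a b) = 1 + nodes a + nodes b"

primrec left :: "data \<Rightarrow> data" where
  "left Leaf = Leaf"
| "left (Branch a b) = a"

primrec right :: "data \<Rightarrow> data" where
  "right Leaf = Leaf"
| "right (Branch a b) = b"

type_synonym store = "nat \<Rightarrow> data"

datatype expr =
    Var nat
  | LeafE
  | BranchE expr expr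
  | LeftE expr
  | RightE expr
  | EqE expr expr

primrec val :: "expr \<Rightarrow> store \<Rightarrow> data" where
  "val (Var v) s = s v"
| "val LeafE s = Leaf"
| "val (BranchE e f) s = Branch (val e s) (val f s)"
| "val (LeftE e) s = left (val e s)"
| "val (RightE e) s = right (val e s)"
| "val (EqE e f) s = (if val e s = val f s then Branch Leaf Leaf else Leaf)"

primrec cost :: "expr \<Rightarrow> store \<Rightarrow> nat" where
  "cost (Var v) s = 1 + nodes (s v)"
| "cost LeafE s = 1 + nodes Leaf"
| "cost (BranchE e f) s = 1 + cost e s + cost f s + nodes (val (BranchE e f) s)"
| "cost (LeftE e) s = 1 + cost e s + nodes (val (LeftE e) s)"
| "cost (RightE e) s = 1 + cost e s + nodes (val (RightE e) s)"
| "cost (EqE e f) s = 1 + cost e s + cost f s + nodes (val (EqE e f) s)"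

datatype prog =
    Skip
  | Assign nat expr
  | Output expr
  | Seq prog prog
  | Cond expr prog prog
  | Loop expr prog

text \<open>
  In \<open>exec c s s' t os\<close>, the program \<open>c\<close> started in store \<open>s\<close> halts in store \<open>s'\<close> after time \<open>t\<close>;
  the list \<open>os\<close> contains, in chronological order, the values output, each with the time elapsed
  since the start when it is output.  \<^const>\<open>Leaf\<close> is the truth value false, all other trees
  are true.
\<close>

definition delay :: "nat \<Rightarrow> (nat \<times> data) list \<Rightarrow> (nat \<times> data) list" where
  "delay t os = map (\<lambda>(u, d). (t + u, d)) os"

inductive exec :: "prog \<Rightarrow> store \<Rightarrow> store \<Rightarrow> nat \<Rightarrow> (nat \<times> data) list \<Rightarrow> bool" where
  exec_Skip: "exec Skip s s 1 []"
| exec_Assign: "exec (Assign v e) s (s(v := val e s)) (1 + cost e s) []"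
| exec_Output: "exec (Output e) s s (1 + cost e s) [(1 + cost e s, val e s)]"
| exec_Seq: "exec c s s' t os \<Longrightarrow> exec c' s' s'' t' os' \<Longrightarrow>
    exec (Seq c c') s s'' (t + t') (os @ delay t os')"
| exec_CondTrue: "val e s \<noteq> Leaf \<Longrightarrow> exec c s s' t os \<Longrightarrow>
    exec (Cond e c c') s s' (1 + cost e s + t) (delay (1 + cost e s) os)"
| exec_CondFalse: "val e s = Leaf \<Longrightarrow> exec c' s s' t os \<Longrightarrow>
    exec (Cond e c c') s s' (1 + cost e s + t) (delay (1 + cost e s) os)"
| exec_LoopTrue: "val e s \<noteq> Leaf \<Longrightarrow> exec c s s' t os \<Longrightarrow> exec (Loop e c) s' s'' t' os' \<Longrightarrow>
    exec (Loop e c) s s'' (1 + cost e s + t + t')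
      (delay (1 + cost e s) os @ delay (1 + cost e s + t) os')"
| exec_LoopFalse: "val e s = Leaf \<Longrightarrow> exec (Loop e c) s s (1 + cost e s) []"

lemma exec_deterministic:
  "exec c s s1 t1 os1 \<Longrightarrow> exec c s s2 t2 os2 \<Longrightarrow> s1 = s2 \<and> t1 = t2 \<and> os1 = os2"
proof (induction arbitrary: s2 t2 os2 rule: exec.induct)
  case (exec_Seq c s s' t os c' s'' t' os')
  from exec_Seq.prems show ?case
    by cases (use exec_Seq.IH in blast)
next
  case (exec_LoopTrue e s c s' t os s'' t' os')
  from exec_LoopTrue.prems show ?case
    by cases (use exec_LoopTrue.IH exec_LoopTrue.hyps in blast)+
next
  case (exec_CondTrue e s c s' t os c')
  from exec_CondTrue.prems show ?case
    by cases (use exec_CondTrue.IH exec_CondTrue.hyps in blast)+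
next
  case (exec_CondFalse e s c' s' t os c)
  from exec_CondFalse.prems show ?case
    by cases (use exec_CondFalse.IH exec_CondFalse.hyps in blast)+
qed (auto elim: exec.cases)

definition initial_store :: "data \<Rightarrow> store" where
  "initial_store w = (\<lambda>v. Leaf)(0 := w)"

text \<open>The time of the \<open>i\<close>-th output, counting from 1; time 0 is the start of the computation.\<close>

definition output_time :: "(nat \<times> data) list \<Rightarrow> nat \<Rightarrow> nat" where
  "output_time os i = (if i = 0 then 0 else fst (os ! (i - 1)))"

text \<open>
  \<open>enc_in w x\<close> means that the tree \<open>w\<close> is an encoding of the input \<open>x\<close>, and \<open>enc_out d y\<close> that
  \<open>d\<close> is an encoding of the solution \<open>y\<close>; \<open>R x\<close> is the set of solutions of \<open>x\<close>, and \<open>I\<close> is the set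
  of inputs to which the problem is restricted.  The size of an input is the size of its encoding.
  Every solution is output exactly once.  The case \<open>i = 0\<close> bounds the time before the first output;
  without it an algorithm could compute all solutions before printing any.
\<close>

definition enumerable_in_incremental_polynomial_time ::
  "(data \<Rightarrow> 'i \<Rightarrow> bool) \<Rightarrow> (data \<Rightarrow> 's \<Rightarrow> bool) \<Rightarrow> ('i \<Rightarrow> 's set) \<Rightarrow> 'i set \<Rightarrow> bool" where
  "enumerable_in_incremental_polynomial_time enc_in enc_out R I \<longleftrightarrow>
    (\<exists>(c :: prog) (p :: nat poly). \<forall>x\<in>I. \<forall>w. enc_in w x \<longrightarrow>
      (\<exists>s' t os ys.
        exec c (initial_store w) s' t os \<and>
        distinct ys \<and> set ys = R x \<and> list_all2 enc_out (map snd os) ys \<and>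
        (\<forall>i < length os. output_time os (Suc i) \<le> output_time os i + poly p (nodes w + i)) \<and>
        t \<le> output_time os (length os) + poly p (nodes w)))"

definition implicational_base :: "'a set \<Rightarrow> ('a set \<times> 'a set) set \<Rightarrow> bool" where
  "implicational_base X \<Sigma> \<longleftrightarrow> (\<forall>(A, B)\<in>\<Sigma>. A \<subseteq> X \<and> B \<subseteq> X)"

definition satisfies :: "'a set \<Rightarrow> ('a set \<times> 'a set) set \<Rightarrow> bool" where
  "satisfies F \<Sigma> \<longleftrightarrow> (\<forall>(A, B)\<in>\<Sigma>. A \<subseteq> F \<longrightarrow> B \<subseteq> F)"

definition closure_system :: "'a set \<Rightarrow> ('a set \<times> 'a set) set \<Rightarrow> 'a set set" where
  "closure_system X \<Sigma> = {F. F \<subseteq> X \<and> satisfies F \<Sigma>}"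

definition simple_graph :: "'a set \<Rightarrow> 'a set set \<Rightarrow> bool" where
  "simple_graph X E \<longleftrightarrow> (\<forall>e\<in>E. \<exists>u\<in>X. \<exists>v\<in>X. u \<noteq> v \<and> e = {u, v})"

definition independent_set :: "'a set set \<Rightarrow> 'a set \<Rightarrow> bool" where
  "independent_set E F \<longleftrightarrow> (\<forall>e\<in>E. \<not> e \<subseteq> F)"

type_synonym 'a mcc_input = "'a set \<times> ('a set \<times> 'a set) set \<times> 'a set set"

fun mcc_instance :: "'a mcc_input \<Rightarrow> bool" where
  "mcc_instance (X, \<Sigma>, E) \<longleftrightarrow>
    finite X \<and> implicational_base X \<Sigma> \<and> simple_graph X E \<and> E \<noteq> {}"

fun maxCC :: "'a mcc_input \<Rightarrow> 'a set set" where
  "maxCC (X, \<Sigma>, E) =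
    (let C = {F \<in> closure_system X \<Sigma>. independent_set E F}
     in {F \<in> C. \<forall>F'\<in>C. F \<subseteq> F' \<longrightarrow> F' = F})"

primrec data_of_list :: "data list \<Rightarrow> data" where
  "data_of_list [] = Leaf"
| "data_of_list (d # ds) = Branch d (data_of_list ds)"

text \<open>A set is encoded by a list, in any order, of encodings of its elements.\<close>

definition enc_set :: "(data \<Rightarrow> 'b \<Rightarrow> bool) \<Rightarrow> data \<Rightarrow> 'b set \<Rightarrow> bool" where
  "enc_set enc d S \<longleftrightarrow>
    (\<exists>xs ds. distinct xs \<and> set xs = S \<and> list_all2 enc ds xs \<and> d = data_of_list ds)"

definition enc_pair ::
  "(data \<Rightarrow> 'b \<Rightarrow> bool) \<Rightarrow> (data \<Rightarrow> 'c \<Rightarrow> bool) \<Rightarrow> data \<Rightarrow> 'b \<times> 'c \<Rightarrow> bool" where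
  "enc_pair enc enc' d z \<longleftrightarrow>
    (\<exists>a b. enc a (fst z) \<and> enc' b (snd z) \<and> d = Branch a b)"

text \<open>
  The ground set may be an arbitrary finite set of trees, which serve as the names of the elements;
  an element is thus encoded by itself.
\<close>

definition enc_instance :: "data \<Rightarrow> data mcc_input \<Rightarrow> bool" where
  "enc_instance =
    enc_pair (enc_set (=))
      (enc_pair (enc_set (enc_pair (enc_set (=)) (enc_set (=))))
        (enc_set (enc_set (=))))"

text \<open>
  The problem restricted to those inputs whose ground set and closure system satisfy \<open>P\<close>.
  The algorithm receives only the implicational base and the consistency-graph.
\<close>

definition MCCEnum_in_incremental_polynomial_time ::
  "(data set \<Rightarrow> data set set \<Rightarrow> bool) \<Rightarrow> bool" where
  "MCCEnum_in_incremental_polynomial_time P \<longleftrightarrow>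
    enumerable_in_incremental_polynomial_time enc_instance (enc_set (=)) maxCC
      {(X, \<Sigma>, E). mcc_instance (X, \<Sigma>, E) \<and> P X (closure_system X \<Sigma>)}"

definition distributive :: "'a set set \<Rightarrow> bool" where
  "distributive \<F> \<longleftrightarrow> (\<forall>F1\<in>\<F>. \<forall>F2\<in>\<F>. F1 \<union> F2 \<in> \<F>)"

definition poset_convex :: "'a set \<Rightarrow> 'a rel \<Rightarrow> 'a set \<Rightarrow> bool" where
  "poset_convex X r Y \<longleftrightarrow>
    (\<forall>x\<in>Y. \<forall>z\<in>Y. \<forall>y\<in>X. (x, y) \<in> r \<and> (y, z) \<in> r \<longrightarrow> y \<in> Y)"

definition poset_convexity :: "'a set \<Rightarrow> 'a set set \<Rightarrow> bool" where
  "poset_convexity X \<F> \<longleftrightarrow>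
    (\<exists>r. partial_order_on X r \<and> \<F> = {Y. Y \<subseteq> X \<and> poset_convex X r Y})"

definition induced_cycle :: "'a set \<Rightarrow> 'a set set \<Rightarrow> 'a list \<Rightarrow> bool" where
  "induced_cycle V E cs \<longleftrightarrow> length cs \<ge> 3 \<and> distinct cs \<and> set cs \<subseteq> V \<and>
    (\<forall>i j. i < j \<and> j < length cs \<longrightarrow>
      ({cs ! i, cs ! j} \<in> E \<longleftrightarrow> j = Suc i \<or> (i = 0 \<and> Suc j = length cs)))"

definition chordal :: "'a set \<Rightarrow> 'a set set \<Rightarrow> bool" where
  "chordal V E \<longleftrightarrow> simple_graph V E \<and> \<not> (\<exists>cs. induced_cycle V E cs \<and> length cs \<ge> 4)"

definition path_between :: "'a set \<Rightarrow> 'a set set \<Rightarrow> 'a \<Rightarrow> 'a list \<Rightarrow> 'a \<Rightarrow> bool" where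
  "path_between V E x ps y \<longleftrightarrow> ps \<noteq> [] \<and> hd ps = x \<and> last ps = y \<and> distinct ps \<and> set ps \<subseteq> V \<and>
    (\<forall>i. Suc i < length ps \<longrightarrow> {ps ! i, ps ! Suc i} \<in> E)"

definition chordless :: "'a set set \<Rightarrow> 'a list \<Rightarrow> bool" where
  "chordless E ps \<longleftrightarrow> (\<forall>i j. Suc i < j \<and> j < length ps \<longrightarrow> {ps ! i, ps ! j} \<notin> E)"

definition monophonically_convex :: "'a set \<Rightarrow> 'a set set \<Rightarrow> 'a set \<Rightarrow> bool" where
  "monophonically_convex V E Y \<longleftrightarrow>
    (\<forall>x\<in>Y. \<forall>y\<in>Y. \<forall>ps. path_between V E x ps y \<and> chordless E ps \<longrightarrow> set ps \<subseteq> Y)"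

definition chordal_monophonic_convexity :: "'a set \<Rightarrow> 'a set set \<Rightarrow> bool" where
  "chordal_monophonic_convexity X \<F> \<longleftrightarrow>
    (\<exists>E. chordal X E \<and> \<F> = {Y. Y \<subseteq> X \<and> monophonically_convex X E Y})"

definition affine_convex_geometry :: "'v::real_vector set \<Rightarrow> 'v set set" where
  "affine_convex_geometry P = {convex hull Y \<inter> P | Y. Y \<subseteq> P}"

text \<open>
  The elements of \<open>X\<close> are identified with points by the injection \<open>pt\<close>, which is not part of the
  input of the enumeration problem.
\<close>

definition affine_convexity :: "(real ^ 'k) itself \<Rightarrow> 'a set \<Rightarrow> 'a set set \<Rightarrow> bool" where
  "affine_convexity _ X \<F> \<longleftrightarrow>
    (\<exists>pt :: 'a \<Rightarrow> real ^ 'k. inj_on pt X \<and>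
      (\<lambda>F. pt ` F) ` \<F> = affine_convex_geometry (pt ` X))"

end

theory Submission
  imports Defs
begin

text \<open>
  If the closure system has Caratheodory number at most \<open>c\<close>, then every inconsistent set contains an
  inconsistent set of size at most \<open>d = 2 * c\<close>: take \<open>c\<close> generators for each end of the offending
  edge. So the solutions are the maximal independent sets of a hypergraph of dimension at most \<open>d\<close>.
  Given a list \<open>\<S>\<close> of solutions, there is a further one iff some consistent set is contained in no
  member of \<open>\<S>\<close>, and then such a set can be found among the sets of size at most \<open>d\<close> and the
  polynomially many intersections of \<open>d + 1\<close> sets \<open>insert y F\<close> with \<open>F \<in> \<S>\<close>. It extends greedily to a
  new solution. The Caratheodory number is at most 1, 2, 2 and \<open>k + 1\<close> in the four cases.
\<close>

section \<open>Polynomial-time functions on trees\<close>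

text \<open>The same algorithm serves all four cases because the witnessing order, graph or point
  set is never reconstructed: the program works with forward chaining and the constant d, and the
  structure enters only through the proof that d is large enough. The intersections are a form of
  Berge's criterion for conformal hypergraphs: if the chosen elements y are distinct, every element
  of the intersection lies in at least d of the d + 1 sets F. There may be exponentially many
  solutions; running through all (d + 1)-tuples over the list found so far is affordable because
  this list counts towards the size in which the delay has to be polynomial. The remaining obstacle
  is the concrete cost model. It is confined to a class of polynomial-time tree functions closed
  under composition, pairing, case distinction and folds with controlled growth; beyond that, only
  the outer enumeration loop is written as a program.\<close>

lemma poly_nat_mono: "m \<le> n \<Longrightarrow> poly p m \<le> poly p (n :: nat)"
  by (induction p) (auto intro!: add_mono mult_mono)

lemma nodes_pos [simp]: "0 < nodes d"
  by (cases d) auto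

lemma nodes_left: "nodes (left d) \<le> nodes d" and nodes_right: "nodes (right d) \<le> nodes d"
  by (cases d; simp)+

lemma delay_Nil [simp]: "delay t [] = []"
  by (simp add: delay_def)

text \<open>Register \<open>k\<close> holds both the argument and the result, and everything above
  it is scratch space. The claim is made for every store, so whatever earlier subroutines left above
  \<open>k\<close> does no harm.\<close>

definition computes :: "prog \<Rightarrow> nat \<Rightarrow> (data \<Rightarrow> data) \<Rightarrow> nat poly \<Rightarrow> bool" where
  "computes c k f p \<longleftrightarrow> (\<forall>s. \<exists>s' t. exec c s s' t [] \<and> s' k = f (s k) \<and> (\<forall>j<k. s' j = s j) \<and>
    t \<le> poly p (nodes (s k)))"

text \<open>
  A program that touches no register below \<open>k\<close> can be run as a subroutine by a caller keeping its
  own data below \<open>k\<close>; demanding one for every \<open>k\<close> makes renaming of variables superfluous.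
\<close>

definition polytime :: "(data \<Rightarrow> data) \<Rightarrow> bool" where
  "polytime f \<longleftrightarrow> (\<exists>p. (\<forall>x. nodes (f x) \<le> poly p (nodes x)) \<and> (\<forall>k. \<exists>c. computes c k f p))"

lemma computes_mono:
  assumes "computes c k f p" "\<And>n. poly p n \<le> poly q n"
  shows "computes c k f q"
  using assms unfolding computes_def by (meson le_trans)

lemma polytimeI:
  assumes "\<And>x. nodes (f x) \<le> poly p (nodes x)" "\<And>k. \<exists>c. computes c k f q"
  shows "polytime f"
  unfolding polytime_def
proof (intro exI[of _ "p + q"] conjI allI)
  show "nodes (f x) \<le> poly (p + q) (nodes x)" for x
    using assms(1)[of x] by simp
  show "\<exists>c. computes c k f (p + q)" for k
    using assms(2)[of k] computes_mono[of _ k f q "p + q"] by fastforce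
qed

lemma computes_Assign:
  assumes "\<And>s. val e s = f (s k)" "\<And>s. 1 + cost e s \<le> poly p (nodes (s k))"
  shows "computes (Assign k e) k f p"
  unfolding computes_def
proof
  fix s :: store
  have "exec (Assign k e) s (s(k := val e s)) (1 + cost e s) []"
    by (rule exec_Assign)
  then show "\<exists>s' t. exec (Assign k e) s s' t [] \<and> s' k = f (s k) \<and> (\<forall>j<k. s' j = s j) \<and>
      t \<le> poly p (nodes (s k))"
    using assms by (intro exI[of _ "s(k := val e s)"] exI[of _ "1 + cost e s"]) auto
qed

lemma polytime_Assign:
  assumes "\<And>k s. val (e k) s = f (s k)" "\<And>k s. 1 + cost (e k) s \<le> poly p (nodes (s k))"
    "\<And>x. nodes (f x) \<le> poly p (nodes x)"
  shows "polytime f"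
proof (rule polytimeI[OF assms(3)])
  show "\<exists>c. computes c k f p" for k
    using computes_Assign[OF assms(1,2)] by blast
qed

lemma polytime_id: "polytime (\<lambda>x. x)"
  by (rule polytime_Assign[of Var _ "[:2, 1:]"]) auto

lemma polytime_Leaf: "polytime (\<lambda>x. Leaf)"
  by (rule polytime_Assign[of "\<lambda>_. LeafE" _ "[:3:]"]) auto

lemma polytime_left': "polytime left"
proof (rule polytime_Assign[of "\<lambda>k. LeftE (Var k)" _ "[:3, 2:]"], goal_cases)
  case (2 k s) show ?case using nodes_left[of "s k"] by simp
next
  case (3 x) show ?case using nodes_left[of x] by simp
qed simp

lemma polytime_right': "polytime right"
proof (rule polytime_Assign[of "\<lambda>k. RightE (Var k)" _ "[:3, 2:]"], goal_cases)
  case (2 k s) show ?case using nodes_right[of "s k"] by simp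
next
  case (3 x) show ?case using nodes_right[of x] by simp
qed simp

definition truth :: "bool \<Rightarrow> data" where
  "truth b = (if b then Branch Leaf Leaf else Leaf)"

lemma truth_eq_Leaf [simp]: "truth b = Leaf \<longleftrightarrow> \<not> b"
  by (simp add: truth_def)

lemma polytime_eq': "polytime (\<lambda>x. truth (left x = right x))"
proof (rule polytime_Assign[of "\<lambda>k. EqE (LeftE (Var k)) (RightE (Var k))" _ "[:12, 4:]"], goal_cases)
  case (2 k s) show ?case using nodes_left[of "s k"] nodes_right[of "s k"] by simp
qed (auto simp: truth_def)

text \<open>The outer program runs on the result of the inner one, so its time is controlled by the
  size of that result; this is why \<open>polytime\<close> carries a size bound beside the time
  bound.\<close>

lemma polytime_comp:
  assumes "polytime f" "polytime g"
  shows "polytime (\<lambda>x. f (g x))"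
proof -
  obtain p where p: "\<And>x. nodes (f x) \<le> poly p (nodes x)" "\<And>k. \<exists>c. computes c k f p"
    using assms(1) unfolding polytime_def by blast
  obtain q where q: "\<And>x. nodes (g x) \<le> poly q (nodes x)" "\<And>k. \<exists>c. computes c k g q"
    using assms(2) unfolding polytime_def by blast
  show ?thesis
  proof (rule polytimeI[of _ "p \<circ>\<^sub>p q" "q + p \<circ>\<^sub>p q"])
    show "nodes (f (g x)) \<le> poly (p \<circ>\<^sub>p q) (nodes x)" for x
      using p(1)[of "g x"] poly_nat_mono[OF q(1)[of x], of p] by (simp add: poly_pcompose)
    fix k
    obtain c c' where c: "computes c k f p" and c': "computes c' k g q"
      using p(2) q(2) by blast
    show "\<exists>c. computes c k (\<lambda>x. f (g x)) (q + p \<circ>\<^sub>p q)"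
    proof
      show "computes (Seq c' c) k (\<lambda>x. f (g x)) (q + p \<circ>\<^sub>p q)"
        unfolding computes_def
      proof
        fix s :: store
        obtain s1 t1 where 1: "exec c' s s1 t1 []" "s1 k = g (s k)" "\<forall>j<k. s1 j = s j"
          "t1 \<le> poly q (nodes (s k))"
          using c' unfolding computes_def by meson
        obtain s2 t2 where 2: "exec c s1 s2 t2 []" "s2 k = f (s1 k)" "\<forall>j<k. s2 j = s1 j"
          "t2 \<le> poly p (nodes (s1 k))"
          using c unfolding computes_def by meson
        have "exec (Seq c' c) s s2 (t1 + t2) []"
          using exec_Seq[OF 1(1) 2(1)] by simp
        moreover have "t2 \<le> poly p (poly q (nodes (s k)))"
          using 2(4) poly_nat_mono[OF q(1)[of "s k"], of p] 1(2) by simp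
        ultimately show "\<exists>s' t. exec (Seq c' c) s s' t [] \<and> s' k = f (g (s k)) \<and>
            (\<forall>j<k. s' j = s j) \<and> t \<le> poly (q + p \<circ>\<^sub>p q) (nodes (s k))"
          using 1 2 by (intro exI[of _ s2] exI[of _ "t1 + t2"]) (auto simp: poly_pcompose)
      qed
    qed
  qed
qed

lemma polytime_Branch:
  assumes "polytime f" "polytime g"
  shows "polytime (\<lambda>x. Branch (f x) (g x))"
proof -
  obtain p where p: "\<And>x. nodes (f x) \<le> poly p (nodes x)" "\<And>k. \<exists>c. computes c k f p"
    using assms(1) unfolding polytime_def by blast
  obtain q where q: "\<And>x. nodes (g x) \<le> poly q (nodes x)" "\<And>k. \<exists>c. computes c k g q"
    using assms(2) unfolding polytime_def by blast
  show ?thesis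
  proof (rule polytimeI[of _ "1 + p + q" "[:20, 2:] + 3 * p + 3 * q"])
    show "nodes (Branch (f x) (g x)) \<le> poly (1 + p + q) (nodes x)" for x
      using p(1)[of x] q(1)[of x] by simp
    fix k
    obtain c c' where c: "computes c (Suc k) f p" and c': "computes c' (Suc (Suc k)) g q"
      using p(2) q(2) by blast
    \<comment> \<open>Each component works on its own copy of the argument: \<open>k\<close> keeps
      the original and \<open>Suc k\<close> the first result while the second is computed from
      \<open>Suc (Suc k)\<close> upwards.\<close>
    let ?c = "Seq (Assign (Suc k) (Var k)) (Seq c (Seq (Assign (Suc (Suc k)) (Var k))
      (Seq c' (Assign k (BranchE (Var (Suc k)) (Var (Suc (Suc k))))))))"
    have "computes ?c k (\<lambda>x. Branch (f x) (g x)) ([:20, 2:] + 3 * p + 3 * q)"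
      unfolding computes_def
    proof
      fix s :: store
      let ?x = "s k"
      let ?s0 = "s(Suc k := ?x)"
      obtain s1 t1 where 1: "exec c ?s0 s1 t1 []" "s1 (Suc k) = f ?x" "\<forall>j<Suc k. s1 j = ?s0 j"
        "t1 \<le> poly p (nodes ?x)"
        using c unfolding computes_def by (metis fun_upd_same)
      let ?s2 = "s1(Suc (Suc k) := ?x)"
      obtain s3 t3 where 3: "exec c' ?s2 s3 t3 []" "s3 (Suc (Suc k)) = g ?x"
        "\<forall>j<Suc (Suc k). s3 j = ?s2 j" "t3 \<le> poly q (nodes ?x)"
        using c' unfolding computes_def by (metis fun_upd_same)
      have k: "s1 k = ?x" "s3 (Suc k) = f ?x"
        using 1(2,3) 3(3) by auto
      have e0: "exec (Assign (Suc k) (Var k)) s ?s0 (2 + nodes ?x) []"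
        using exec_Assign[of "Suc k" "Var k" s] by simp
      have e2: "exec (Assign (Suc (Suc k)) (Var k)) s1 ?s2 (2 + nodes ?x) []"
        using exec_Assign[of "Suc (Suc k)" "Var k" s1] k by simp
      have e4: "exec (Assign k (BranchE (Var (Suc k)) (Var (Suc (Suc k))))) s3
          (s3(k := Branch (f ?x) (g ?x))) (5 + 2 * nodes (f ?x) + 2 * nodes (g ?x)) []"
        using exec_Assign[of k "BranchE (Var (Suc k)) (Var (Suc (Suc k)))" s3] k 3(2)
        by (simp add: eval_nat_numeral ac_simps)
      note e = exec_Seq[OF e0 exec_Seq[OF 1(1) exec_Seq[OF e2 exec_Seq[OF 3(1) e4]]]]
      show "\<exists>s' t. exec ?c s s' t [] \<and> s' k = Branch (f ?x) (g ?x) \<and>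
          (\<forall>j<k. s' j = s j) \<and> t \<le> poly ([:20, 2:] + 3 * p + 3 * q) (nodes ?x)"
        using e[simplified] 1 3 p(1)[of ?x] q(1)[of ?x]
        by (intro exI[of _ "s3(k := Branch (f ?x) (g ?x))"] exI conjI) auto
    qed
    then show "\<exists>c. computes c k (\<lambda>x. Branch (f x) (g x)) ([:20, 2:] + 3 * p + 3 * q)" ..
  qed
qed

lemma polytime_If':
  assumes "polytime b" "polytime f" "polytime g"
  shows "polytime (\<lambda>x. if b x \<noteq> Leaf then f x else g x)"
proof -
  obtain r where r: "\<And>x. nodes (b x) \<le> poly r (nodes x)" "\<And>k. \<exists>c. computes c k b r"
    using assms(1) unfolding polytime_def by blast
  obtain p where p: "\<And>x. nodes (f x) \<le> poly p (nodes x)" "\<And>k. \<exists>c. computes c k f p"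
    using assms(2) unfolding polytime_def by blast
  obtain q where q: "\<And>x. nodes (g x) \<le> poly q (nodes x)" "\<And>k. \<exists>c. computes c k g q"
    using assms(3) unfolding polytime_def by blast
  show ?thesis
  proof (rule polytimeI[of _ "p + q" "[:20, 2:] + 2 * r + p + q"])
    show "nodes (if b x \<noteq> Leaf then f x else g x) \<le> poly (p + q) (nodes x)" for x
      using p(1)[of x] q(1)[of x] by simp
    fix k
    obtain cb c c' where cb: "computes cb (Suc k) b r" and c: "computes c k f p"
      and c': "computes c' k g q"
      using p(2) q(2) r(2) by blast
    let ?c = "Seq (Assign (Suc k) (Var k)) (Seq cb (Cond (Var (Suc k)) c c'))"
    have "computes ?c k (\<lambda>x. if b x \<noteq> Leaf then f x else g x) ([:20, 2:] + 2 * r + p + q)"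
      unfolding computes_def
    proof
      fix s :: store
      let ?x = "s k"
      let ?s0 = "s(Suc k := ?x)"
      let ?h = "if b ?x \<noteq> Leaf then f ?x else g ?x"
      obtain s1 t1 where 1: "exec cb ?s0 s1 t1 []" "s1 (Suc k) = b ?x" "\<forall>j<Suc k. s1 j = ?s0 j"
        "t1 \<le> poly r (nodes ?x)"
        using cb unfolding computes_def by (metis fun_upd_same)
      have k: "s1 k = ?x"
        using 1(3) by auto
      have e0: "exec (Assign (Suc k) (Var k)) s ?s0 (2 + nodes ?x) []"
        using exec_Assign[of "Suc k" "Var k" s] by simp
      obtain s2 t2 where 2: "exec (Cond (Var (Suc k)) c c') s1 s2 (2 + nodes (b ?x) + t2) []"
        "s2 k = ?h" "\<forall>j<k. s2 j = s1 j" "t2 \<le> poly (p + q) (nodes ?x)"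
      proof (cases "b ?x = Leaf")
        case True
        obtain s2 t2 where "exec c' s1 s2 t2 []" "s2 k = g ?x" "\<forall>j<k. s2 j = s1 j"
          "t2 \<le> poly q (nodes ?x)"
          using c' k unfolding computes_def by metis
        then show thesis
          using that[of s2 t2] True exec_CondFalse[of "Var (Suc k)" s1 c' s2 t2 "[]" c] 1(2) by (simp add: eval_nat_numeral)
      next
        case False
        obtain s2 t2 where "exec c s1 s2 t2 []" "s2 k = f ?x" "\<forall>j<k. s2 j = s1 j"
          "t2 \<le> poly p (nodes ?x)"
          using c k unfolding computes_def by metis
        then show thesis
          using that[of s2 t2] False exec_CondTrue[of "Var (Suc k)" s1 c s2 t2 "[]" c'] 1(2) by (simp add: eval_nat_numeral)
      qed
      note e = exec_Seq[OF e0 exec_Seq[OF 1(1) 2(1)]]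
      show "\<exists>s' t. exec ?c s s' t [] \<and> s' k = ?h \<and>
          (\<forall>j<k. s' j = s j) \<and> t \<le> poly ([:20, 2:] + 2 * r + p + q) (nodes ?x)"
        using e[simplified] 1 2 r(1)[of ?x]
        by (intro exI[of _ s2] exI conjI) auto
    qed
    then show "\<exists>c. computes c k (\<lambda>x. if b x \<noteq> Leaf then f x else g x)
        ([:20, 2:] + 2 * r + p + q)" ..
  qed
qed

lemma polytime_left: "polytime f \<Longrightarrow> polytime (\<lambda>x. left (f x))"
  by (rule polytime_comp[OF polytime_left'])

lemma polytime_right: "polytime f \<Longrightarrow> polytime (\<lambda>x. right (f x))"
  by (rule polytime_comp[OF polytime_right'])

lemma polytime_comp2:
  assumes "polytime (\<lambda>x. f (left x) (right x))" "polytime g" "polytime h"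
  shows "polytime (\<lambda>x. f (g x) (h x))"
  using polytime_comp[OF assms(1) polytime_Branch[OF assms(2,3)]] by simp

section \<open>Polynomial-time predicates\<close>

definition polytime_pred :: "(data \<Rightarrow> bool) \<Rightarrow> bool" where
  "polytime_pred P \<longleftrightarrow> polytime (\<lambda>x. truth (P x))"

lemma polytime_If:
  assumes "polytime_pred P" "polytime f" "polytime g"
  shows "polytime (\<lambda>x. if P x then f x else g x)"
  using polytime_If'[OF assms[unfolded polytime_pred_def]] by simp

lemma polytime_pred_eq:
  assumes "polytime f" "polytime g"
  shows "polytime_pred (\<lambda>x. f x = g x)"
  using polytime_comp[OF polytime_eq' polytime_Branch[OF assms]] by (simp add: polytime_pred_def)

lemma polytime_pred_If:
  assumes "polytime_pred P" "polytime_pred Q" "polytime_pred R"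
  shows "polytime_pred (\<lambda>x. if P x then Q x else R x)"
  unfolding polytime_pred_def if_distrib[of truth]
  by (intro polytime_If assms assms[unfolded polytime_pred_def])

lemma polytime_pred_const: "polytime_pred (\<lambda>x. b)"
proof -
  have "(\<lambda>x. truth b) = (\<lambda>x. if b then Branch Leaf Leaf else Leaf)"
    by (auto simp: truth_def)
  then show ?thesis
    unfolding polytime_pred_def
    by (cases b) (simp_all add: truth_def polytime_Leaf polytime_Branch)
qed

lemma polytime_pred_not: "polytime_pred P \<Longrightarrow> polytime_pred (\<lambda>x. \<not> P x)"
  using polytime_pred_If[OF _ polytime_pred_const[of False] polytime_pred_const[of True], of P]
  by (simp cong: if_cong add: if_bool_eq_conj)

lemma polytime_pred_conj: "polytime_pred P \<Longrightarrow> polytime_pred Q \<Longrightarrow> polytime_pred (\<lambda>x. P x \<and> Q x)"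
  using polytime_pred_If[OF _ _ polytime_pred_const[of False], of P Q]
  by (simp cong: conj_cong add: if_bool_eq_disj)

lemma polytime_pred_disj: "polytime_pred P \<Longrightarrow> polytime_pred Q \<Longrightarrow> polytime_pred (\<lambda>x. P x \<or> Q x)"
  using polytime_pred_not[OF polytime_pred_conj[OF polytime_pred_not polytime_pred_not], of P Q]
  by simp

section \<open>Trees as lists, and bounded iteration over them\<close>

primrec list_of :: "data \<Rightarrow> data list" where
  "list_of Leaf = []"
| "list_of (Branch a b) = a # list_of b"

lemma list_of_data_of_list [simp]: "list_of (data_of_list ds) = ds"
  by (induction ds) auto

lemma data_of_list_list_of [simp]: "data_of_list (list_of d) = d"
  by (induction d) auto

lemma nodes_elem: "x \<in> set (list_of d) \<Longrightarrow> nodes x \<le> nodes d"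
  by (induction d) auto

lemma length_list_of: "length (list_of d) < nodes d"
  by (induction d) auto

lemma nodes_data_of_list: "nodes (data_of_list ds) = 1 + (\<Sum>x\<leftarrow>ds. 1 + nodes x)"
  by (induction ds) auto

lemma nodes_filter: "nodes (data_of_list (filter P ds)) \<le> nodes (data_of_list ds)"
  by (induction ds) auto

text \<open>
  The state of a loop over a list is \<open>Branch e (Branch acc ds)\<close>: environment, accumulator and the
  part of the list still to be traversed.
\<close>

lemma fold_loop:
  fixes step :: "data \<Rightarrow> data \<Rightarrow> data \<Rightarrow> data"
  defines "g \<equiv> (\<lambda>z. Branch (left z) (Branch
    (step (left z) (left (right z)) (left (right (right z)))) (right (right (right z)))))"
  assumes c: "computes c k g p"
  assumes B: "\<And>acc x. nodes x \<le> N \<Longrightarrow> nodes (step e acc x) \<le> nodes acc + B"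
  assumes "s k = Branch e (Branch acc ds)" "nodes ds \<le> N"
    "2 + nodes e + nodes acc + nodes ds + length (list_of ds) * B \<le> M"
  shows "\<exists>s' t. exec (Loop (RightE (RightE (Var k))) c) s s' t [] \<and>
    s' k = Branch e (Branch (foldl (step e) acc (list_of ds)) Leaf) \<and> (\<forall>j<k. s' j = s j) \<and>
    t \<le> Suc (length (list_of ds)) * (4 + 3 * M + poly p M)"
  using assms(4-)
proof (induction ds arbitrary: s acc)
  case Leaf
  have "exec (Loop (RightE (RightE (Var k))) c) s s (1 + cost (RightE (RightE (Var k))) s) []"
    using Leaf by (intro exec_LoopFalse) simp
  then show ?case
    using Leaf by (intro exI[of _ s] exI conjI) (auto intro: order_trans)
next
  case (Branch x ds)
  obtain s1 t1 where 1: "exec c s s1 t1 []" "s1 k = Branch e (Branch (step e acc x) ds)"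
    "\<forall>j<k. s1 j = s j" "t1 \<le> poly p (nodes (s k))"
    using c[unfolded computes_def, rule_format, of s] Branch.prems(1) unfolding g_def by auto
  have "nodes (step e acc x) \<le> nodes acc + B"
    using B[of x acc] Branch.prems(2) by simp
  \<comment> \<open>The remaining list gets shorter by one element whenever the accumulator may gain
    \<open>B\<close>, so the same \<open>M\<close> bounds the state in every round.\<close>
  then have "2 + nodes e + nodes (step e acc x) + nodes ds + length (list_of ds) * B \<le> M"
    using Branch.prems(3) by simp
  then obtain s2 t2 where 2: "exec (Loop (RightE (RightE (Var k))) c) s1 s2 t2 []"
    "s2 k = Branch e (Branch (foldl (step e) (step e acc x) (list_of ds)) Leaf)"
    "\<forall>j<k. s2 j = s1 j" "t2 \<le> Suc (length (list_of ds)) * (4 + 3 * M + poly p M)"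
    using Branch.IH(2)[where s = s1 and acc = "step e acc x", OF 1(2)] Branch.prems(2) by auto
  have sk: "nodes (s k) \<le> M"
    using Branch.prems(1,3) by simp
  let ?t = "1 + cost (RightE (RightE (Var k))) s + t1 + t2"
  have "exec (Loop (RightE (RightE (Var k))) c) s s2 ?t []"
    using exec_LoopTrue[OF _ 1(1) 2(1)] Branch.prems(1) by simp
  moreover have "?t \<le> Suc (length (list_of (Branch x ds))) * (4 + 3 * M + poly p M)"
    using 2(4) 1(4) poly_nat_mono[OF sk, of p] sk Branch.prems(1) by simp
  ultimately show ?case
    using 1 2 by (intro exI[of _ s2] exI[of _ ?t]) auto
qed

lemma nodes_foldl:
  fixes step :: "data \<Rightarrow> data \<Rightarrow> data"
  assumes "\<And>x. x \<in> set ds \<Longrightarrow> nodes x \<le> N" "\<And>acc x. nodes x \<le> N \<Longrightarrow> nodes (step acc x) \<le> nodes acc + B"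
  shows "nodes (foldl step acc ds) \<le> nodes acc + length ds * B"
  using assms(1)
proof (induction ds arbitrary: acc)
  case (Cons x ds)
  have "nodes (foldl step (step acc x) ds) \<le> nodes (step acc x) + length ds * B"
    using Cons by simp
  then show ?case
    using assms(2)[of x acc] Cons.prems[of x] by simp
qed simp

text \<open>Iterating a polynomial-time step can produce exponential size, for instance by doubling
  the accumulator. The bound \<open>q\<close> rules this out: a step may add only an amount that
  depends on the environment and the current element, so the total growth is at most the number of
  rounds times a polynomial.\<close>

lemma polytime_fold':
  fixes step :: "data \<Rightarrow> data \<Rightarrow> data \<Rightarrow> data"
  assumes step: "polytime (\<lambda>z. step (left z) (left (right z)) (right (right z)))"
    and q: "\<And>e acc x. nodes (step e acc x) \<le> nodes acc + poly q (nodes e + nodes x)"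
  shows "polytime (\<lambda>z. foldl (step (left z)) (left (right z)) (list_of (right (right z))))"
proof -
  define g where "g = (\<lambda>z. Branch (left z) (Branch
    (step (left z) (left (right z)) (left (right (right z)))) (right (right (right z)))))"
  let ?f = "\<lambda>z :: data. foldl (step (left z)) (left (right z)) (list_of (right (right z)))"
  have "polytime (\<lambda>z. step (left z) (left (right z)) (left (right (right z))))"
    using polytime_comp[OF step, of "\<lambda>z. Branch (left z) (Branch (left (right z)) (left (right (right z))))"]
    by (simp add: polytime_Branch polytime_left polytime_right polytime_id)
  then have "polytime g"
    unfolding g_def by (intro polytime_Branch polytime_left polytime_right polytime_id)
  then obtain p where p: "\<And>k. \<exists>c. computes c k g p"
    unfolding polytime_def by blast
  let ?M = "[:0, 1:] + [:0, 1:] * q"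
  let ?p = "[:1, 1:] * ([:4:] + 3 * ?M + p \<circ>\<^sub>p ?M)"
  \<comment> \<open>The exact effect of the loop on an arbitrary tree, as \<open>computes\<close>
    prescribes a result for each. If \<open>right z\<close> is \<open>Leaf\<close>, the loop test
    fails at once and the state stays as it is.\<close>
  define h where "h = (\<lambda>z. if right z = Leaf then z else Branch (left z) (Branch (?f z) Leaf))"
  have h: "polytime h"
  proof (rule polytimeI)
    fix z
    show "nodes (h z) \<le> poly ?M (nodes z)"
    proof (cases "right z = Leaf")
      case True
      then show ?thesis by (simp add: h_def)
    next
      case False
      then obtain e acc ds where z: "z = Branch e (Branch acc ds)"
        by (metis data.exhaust left.simps right.simps)
      have B: "nodes (step e acc x) \<le> nodes acc + poly q (nodes z)" if "nodes x \<le> nodes ds" for acc x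
        using q[of e acc x] poly_nat_mono[of "nodes e + nodes x" "nodes z" q] that z by simp
      have "nodes (?f z) \<le> nodes acc + length (list_of ds) * poly q (nodes z)"
        using nodes_foldl[of "list_of ds" "nodes ds" "step e", OF _ B, of acc] nodes_elem[of _ ds] z by simp
      also have "\<dots> \<le> nodes acc + nodes z * poly q (nodes z)"
        using length_list_of[of ds] z by (intro add_left_mono mult_right_mono) auto
      finally show ?thesis
        using z nodes_pos[of ds] by (simp add: h_def del: nodes_pos)
    qed
  next
    fix k
    obtain c where c: "computes c k g p" using p by blast
    have "computes (Loop (RightE (RightE (Var k))) c) k h ?p"
      unfolding computes_def
    proof
      fix s :: store
      let ?l = "Loop (RightE (RightE (Var k))) c"
      let ?n = "nodes (s k)"
      show "\<exists>s' t. exec ?l s s' t [] \<and> s' k = h (s k) \<and> (\<forall>j<k. s' j = s j) \<and> t \<le> poly ?p ?n"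
      proof (cases "right (s k) = Leaf")
        case True
        have "exec ?l s s (1 + cost (RightE (RightE (Var k))) s) []"
          using True by (intro exec_LoopFalse) simp
        then show ?thesis
          using True Suc_leI[OF nodes_pos[of "s k"]]
          by (intro exI[of _ s] exI conjI) (auto simp: h_def algebra_simps)
      next
        case False
        then obtain e acc ds where z: "s k = Branch e (Branch acc ds)"
          by (metis data.exhaust left.simps right.simps)
        have B: "nodes (step e acc x) \<le> nodes acc + poly q ?n" if "nodes x \<le> nodes ds" for acc x
          using q[of e acc x] poly_nat_mono[of "nodes e + nodes x" ?n q] that z by simp
        have len: "length (list_of ds) \<le> ?n"
          using length_list_of[of ds] z by simp
        then have "length (list_of ds) * poly q ?n \<le> ?n * poly q ?n"
          by (rule mult_right_mono) simp
        then have "2 + nodes e + nodes acc + nodes ds + length (list_of ds) * poly q ?n \<le> poly ?M ?n"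
          using z by simp
        from fold_loop[where step = step and s = s and e = e and acc = acc and ds = ds, OF c[unfolded g_def] B z order_refl this]
        obtain s' t where "exec ?l s s' t []"
          "s' k = Branch e (Branch (foldl (step e) acc (list_of ds)) Leaf)" "\<forall>j<k. s' j = s j"
          "t \<le> Suc (length (list_of ds)) * (4 + 3 * poly ?M ?n + poly p (poly ?M ?n))"
          by blast
        moreover have "Suc (length (list_of ds)) * (4 + 3 * poly ?M ?n + poly p (poly ?M ?n)) \<le>
            poly ?p ?n"
        proof -
          have "poly ?p ?n = Suc ?n * (4 + 3 * poly ?M ?n + poly p (poly ?M ?n))"
            by (simp add: poly_pcompose algebra_simps)
          then show ?thesis
            using len by (metis Suc_le_mono mult_le_mono1)
        qed
        ultimately show ?thesis
          using z by (intro exI[of _ s'] exI[of _ t]) (auto simp: h_def)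
      qed
    qed
    then show "\<exists>c. computes c k h ?p" ..
  qed
  have "polytime (\<lambda>z. left (right (h (Branch (left z) (Branch (left (right z)) (right (right z)))))))"
    by (intro polytime_left polytime_right polytime_comp[OF h] polytime_Branch polytime_id)
  then show ?thesis
    by (simp add: h_def)
qed

lemma polytime_foldl:
  fixes step :: "data \<Rightarrow> data \<Rightarrow> data \<Rightarrow> data"
  assumes "polytime (\<lambda>z. step (left z) (left (right z)) (right (right z)))"
    and "\<And>e acc x. nodes (step e acc x) \<le> nodes acc + poly q (nodes e + nodes x)"
    and "polytime f" "polytime l"
  shows "polytime (\<lambda>e. foldl (step e) (f e) (list_of (l e)))"
  using polytime_comp[OF polytime_fold'[OF assms(1,2)]
      polytime_Branch[OF polytime_id polytime_Branch[OF assms(3,4)]]]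
  by simp

text \<open>Functions into lists are measured through the bijection \<^const>\<open>data_of_list\<close>.\<close>

definition polytime_list :: "(data \<Rightarrow> data list) \<Rightarrow> bool" where
  "polytime_list f \<longleftrightarrow> polytime (\<lambda>x. data_of_list (f x))"

lemma polytime_data_of_list: "polytime_list f \<Longrightarrow> polytime (\<lambda>x. data_of_list (f x))"
  by (simp add: polytime_list_def)

lemma polytime_list_of: "polytime f \<Longrightarrow> polytime_list (\<lambda>x. list_of (f x))"
  by (simp add: polytime_list_def)

lemma polytime_Nil: "polytime_list (\<lambda>x. [])"
  by (simp add: polytime_list_def polytime_Leaf)

lemma polytime_Cons: "polytime f \<Longrightarrow> polytime_list g \<Longrightarrow> polytime_list (\<lambda>x. f x # g x)"
  by (simp add: polytime_list_def polytime_Branch)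

lemma polytime_list_If:
  "polytime_pred P \<Longrightarrow> polytime_list f \<Longrightarrow> polytime_list g \<Longrightarrow> polytime_list (\<lambda>x. if P x then f x else g x)"
  unfolding polytime_list_def if_distrib[of data_of_list] by (rule polytime_If)

lemma foldl_Branch: "foldl (\<lambda>acc x. Branch x acc) d ds = data_of_list (rev ds @ list_of d)"
  by (induction ds arbitrary: d) auto

lemma polytime_revapp:
  assumes "polytime_list f" "polytime_list g"
  shows "polytime_list (\<lambda>x. rev (f x) @ g x)"
proof -
  have "polytime (\<lambda>e. foldl (\<lambda>acc x. Branch x acc) (data_of_list (g e)) (list_of (data_of_list (f e))))"
    by (rule polytime_foldl[where q = "[:1, 1:]"], goal_cases)
      (intro polytime_Branch polytime_left polytime_right polytime_id | simp |
        rule assms[unfolded polytime_list_def])+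
  then show ?thesis
    by (simp add: foldl_Branch polytime_list_def)
qed

lemma polytime_rev: "polytime_list f \<Longrightarrow> polytime_list (\<lambda>x. rev (f x))"
  using polytime_revapp[OF _ polytime_Nil] by simp

lemma polytime_append: "polytime_list f \<Longrightarrow> polytime_list g \<Longrightarrow> polytime_list (\<lambda>x. f x @ g x)"
  using polytime_revapp[OF polytime_rev] by simp

lemma nodes_append: "nodes (data_of_list (xs @ ys)) \<le> nodes (data_of_list xs) + nodes (data_of_list ys)"
  by (induction xs) auto

lemma foldl_append: "foldl (\<lambda>acc x. data_of_list (f x @ list_of acc)) d ds =
    data_of_list (concat (map f (rev ds)) @ list_of d)"
  by (induction ds arbitrary: d) auto

lemma polytime_concat_map:
  assumes f: "polytime_list (\<lambda>z. f (left z) (right z))" and l: "polytime_list l"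
  shows "polytime_list (\<lambda>e. concat (map (f e) (l e)))"
proof -
  obtain p where p: "\<And>z. nodes (data_of_list (f (left z) (right z))) \<le> poly p (nodes z)"
    using f unfolding polytime_list_def polytime_def by blast
  \<comment> \<open>Every step puts its piece in front, so the list is traversed backwards. The
    piece depends on \<open>e\<close> and \<open>x\<close> alone, which gives the additive growth
    bound.\<close>
  have "polytime (\<lambda>e. foldl (\<lambda>acc x. data_of_list (f e x @ list_of acc)) Leaf
      (list_of (data_of_list (rev (l e)))))"
  proof (rule polytime_foldl[where q = "p \<circ>\<^sub>p [:1, 1:]"])
    have "polytime_list (\<lambda>z. f (left z) (right (right z)))"
      using polytime_comp[OF f[unfolded polytime_list_def], of "\<lambda>z. Branch (left z) (right (right z))"]
      by (simp add: polytime_list_def polytime_Branch polytime_left polytime_right polytime_id)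
    then show "polytime (\<lambda>z. data_of_list (f (left z) (right (right z)) @ list_of (left (right z))))"
      by (intro polytime_data_of_list polytime_append polytime_list_of polytime_left polytime_right
        polytime_id)
    fix e acc x
    show "nodes (data_of_list (f e x @ list_of acc)) \<le> nodes acc + poly (p \<circ>\<^sub>p [:1, 1:]) (nodes e + nodes x)"
      using nodes_append[of "f e x" "list_of acc"] p[of "Branch e x"] by (simp add: poly_pcompose)
  qed (use l in \<open>auto intro: polytime_rev polytime_Leaf polytime_data_of_list\<close>)
  then show ?thesis
    by (simp add: foldl_append polytime_list_def)
qed

lemma polytime_map:
  assumes "polytime (\<lambda>z. f (left z) (right z))" "polytime_list l"
  shows "polytime_list (\<lambda>e. map (f e) (l e))"
proof -
  have *: "concat (map (\<lambda>x. [g x]) xs) = map g xs" for g :: "data \<Rightarrow> data" and xs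
    by (induction xs) auto
  show ?thesis
    using polytime_concat_map[of "\<lambda>e x. [f e x]", OF polytime_Cons[OF assms(1) polytime_Nil] assms(2)]
    by (simp add: *)
qed

lemma polytime_filter:
  assumes "polytime_pred (\<lambda>z. P (left z) (right z))" "polytime_list l"
  shows "polytime_list (\<lambda>e. filter (P e) (l e))"
proof -
  have *: "concat (map (\<lambda>x. if Q x then [x] else []) xs) = filter Q xs" for Q :: "data \<Rightarrow> bool" and xs
    by (induction xs) auto
  have "polytime_list (\<lambda>z. if P (left z) (right z) then [right z] else [])"
    by (intro polytime_list_If assms(1) polytime_Cons polytime_Nil polytime_right polytime_id)
  from polytime_concat_map[of "\<lambda>e x. if P e x then [x] else []", OF this assms(2)]
  show ?thesis
    by (simp add: *)
qed

lemma polytime_pred_Bex: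
  assumes "polytime_pred (\<lambda>z. P (left z) (right z))" "polytime_list l"
  shows "polytime_pred (\<lambda>e. \<exists>x\<in>set (l e). P e x)"
proof -
  have "polytime_pred (\<lambda>e. \<not> data_of_list (filter (P e) (l e)) = Leaf)"
    by (intro polytime_pred_not polytime_pred_eq polytime_data_of_list polytime_filter assms polytime_Leaf)
  moreover have "data_of_list xs = Leaf \<longleftrightarrow> xs = []" for xs
    by (cases xs) auto
  ultimately show ?thesis
    by (simp add: filter_empty_conv)
qed

lemma polytime_pred_Ball:
  assumes "polytime_pred (\<lambda>z. P (left z) (right z))" "polytime_list l"
  shows "polytime_pred (\<lambda>e. \<forall>x\<in>set (l e). P e x)"
  using polytime_pred_not[OF polytime_pred_Bex[of "\<lambda>e x. \<not> P e x", OF polytime_pred_not[OF assms(1)] assms(2)]]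
  by simp

lemmas polytime_intros = polytime_pred_If polytime_pred_conj polytime_pred_disj polytime_pred_not
  polytime_pred_eq polytime_pred_Bex polytime_pred_Ball polytime_list_If polytime_If polytime_filter
  polytime_map polytime_concat_map polytime_append polytime_Cons polytime_Nil polytime_list_of
  polytime_data_of_list polytime_Branch polytime_left polytime_right polytime_Leaf polytime_id

section \<open>Incremental enumeration\<close>

lemma output_time_delay:
  "i \<le> length os \<Longrightarrow> output_time (delay T os) i = (if i = 0 then 0 else T + output_time os i)"
  by (auto simp: output_time_def delay_def split: prod.split)

lemma output_time_Cons_delay:
  "i \<le> length os \<Longrightarrow> output_time ((T, F) # delay T os) (Suc i) = T + output_time os i"
  by (auto simp: output_time_def delay_def nth_Cons' split: prod.split)

lemma delay_delay [simp]: "delay a (delay b os) = delay (a + b) os"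
  by (auto simp: delay_def)

lemma length_delay [simp]: "length (delay T os) = length os"
  by (simp add: delay_def)

lemma map_snd_delay [simp]: "map snd (delay T os) = map snd os"
  by (auto simp: delay_def)

text \<open>Register 0 keeps the input throughout. The subroutine \<open>c\<close> works from
  register 3 upwards, hence the copying of its argument into 3 and of its result into 2.\<close>

definition update_next :: "prog \<Rightarrow> prog" where
  "update_next c = Seq (Assign 3 (BranchE (Var 0) (Var 1))) (Seq c (Assign 2 (Var 3)))"

lemma exec_update_next:
  assumes c: "computes c 3 (\<lambda>z. new (left z) (right z)) p"
    and size: "\<And>z. nodes (new (left z) (right z)) \<le> poly p (nodes z)"
  shows "\<exists>s' t. exec (update_next c) s s' t [] \<and> s' 0 = s 0 \<and> s' 1 = s 1 \<and>
    s' 2 = new (s 0) (s 1) \<and>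
    t \<le> poly ([:7, 2:] + 2 * p \<circ>\<^sub>p [:1, 1:]) (nodes (s 0) + nodes (s 1))"
proof -
  let ?s0 = "s(3 := Branch (s 0) (s 1))"
  have e0: "exec (Assign 3 (BranchE (Var 0) (Var 1))) s ?s0 (5 + 2 * (nodes (s 0) + nodes (s 1))) []"
    using exec_Assign[of 3 "BranchE (Var 0) (Var 1)" s] by (simp add: eval_nat_numeral ac_simps)
  obtain s1 t1 where 1: "exec c ?s0 s1 t1 []" "s1 3 = new (s 0) (s 1)" "\<forall>j<3. s1 j = ?s0 j"
    "t1 \<le> poly p (1 + nodes (s 0) + nodes (s 1))"
    using c[unfolded computes_def, rule_format, of ?s0] by (auto simp del: One_nat_def)
  have e2: "exec (Assign 2 (Var 3)) s1 (s1(2 := s1 3)) (2 + nodes (s1 3)) []"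
    using exec_Assign[of 2 "Var 3" s1] by simp
  have "nodes (s1 3) \<le> poly p (1 + nodes (s 0) + nodes (s 1))"
    using size[of "Branch (s 0) (s 1)"] 1(2) by simp
  then show ?thesis
    using exec_Seq[OF e0 exec_Seq[OF 1(1) e2]] 1
    unfolding update_next_def
    by (intro exI[of _ "s1(2 := s1 3)"] exI conjI) (auto simp: poly_pcompose)
qed

text \<open>
  Register 1 holds the solutions found so far, register 2 the next one. A solution is only output
  after its successor has been computed: in this way the last output comes after the expensive test
  that the enumeration is complete, so that nothing remains to be done after it.
\<close>

definition enumerate_body :: "prog \<Rightarrow> prog" where
  "enumerate_body c = Seq (Assign 1 (BranchE (LeftE (Var 2)) (Var 1)))
    (Seq (update_next c) (Output (LeftE (Var 1))))"

definition enumerate_prog :: "prog \<Rightarrow> prog" where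
  "enumerate_prog c = Seq (Assign 1 LeafE) (Seq (update_next c) (Loop (Var 2) (enumerate_body c)))"

lemma nodes_data_of_list_le:
  "(\<And>x. x \<in> set ds \<Longrightarrow> nodes x \<le> N) \<Longrightarrow> nodes (data_of_list ds) \<le> 1 + length ds * (1 + N)"
  by (induction ds) force+

text \<open>Each round of the loop ends with exactly one output, so the gap between two outputs is
  the cost of a round. If \<open>m\<close> solutions are known, that cost is governed by a list of
  \<open>Suc m\<close> trees of size at most \<open>N\<close>. The summand 3 pays for the last loop
  test, which reads a register containing \<open>Leaf\<close>.\<close>

lemma exec_enumerate_loop:
  fixes new :: "data \<Rightarrow> data \<Rightarrow> data" and p :: "nat poly"
  defines "r \<equiv> [:7, 2:] + 2 * p \<circ>\<^sub>p [:1, 1:]"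
  assumes c: "computes c 3 (\<lambda>z. new (left z) (right z)) p"
    and size: "\<And>z. nodes (new (left z) (right z)) \<le> poly p (nodes z)"
    and fin: "finite R"
    and N: "\<forall>y\<in>R. \<forall>F. enc F y \<longrightarrow> nodes F \<le> N"
    and new: "\<And>Fs ys. list_all2 enc Fs ys \<Longrightarrow> distinct ys \<Longrightarrow> set ys \<subseteq> R \<Longrightarrow>
      new w (data_of_list Fs) = Leaf \<and> set ys = R \<or>
      (\<exists>F. \<exists>y\<in>R - set ys. new w (data_of_list Fs) = Branch F Leaf \<and> enc F y)"
    and B: "\<And>m. 20 + 5 * N + 5 * (1 + Suc m * (1 + N)) + poly r (nodes w + (1 + Suc m * (1 + N))) \<le> B m"
    and s: "s 0 = w" "s 1 = data_of_list Fs" "s 2 = new w (s 1)"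
    and ys: "list_all2 enc Fs ys" "distinct ys" "set ys \<subseteq> R"
  shows "\<exists>s' t os zs. exec (Loop (Var 2) (enumerate_body c)) s s' t os \<and> distinct zs \<and>
    set zs = R - set ys \<and> list_all2 enc (map snd os) zs \<and>
    (\<forall>i<length os. output_time os (Suc i) \<le> output_time os i + B (length ys + i)) \<and>
    t \<le> output_time os (length os) + 3"
  using s ys
proof (induction "card (R - set ys)" arbitrary: s Fs ys rule: less_induct)
  case less
  show ?case
  proof (cases "new w (s 1) = Leaf")
    case True
    then have "set ys = R"
      using new[OF less.prems(4-6)] less.prems(2) by auto
    moreover have "exec (Loop (Var 2) (enumerate_body c)) s s (1 + cost (Var 2) s) []"
      using True less.prems(3) by (intro exec_LoopFalse) simp
    ultimately show ?thesis
      using True less.prems(3)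
      by (intro exI[of _ s] exI[of _ "1 + cost (Var 2) s"] exI[of _ "[]"] exI[of _ "[]"])
        (auto simp: output_time_def)
  next
    case False
    then obtain F y where F: "y \<in> R" "y \<notin> set ys" "s 2 = Branch F Leaf" "enc F y"
      using new[OF less.prems(4-6)] less.prems(2,3) by auto
    let ?S = "data_of_list (F # Fs)"
    let ?s1 = "s(1 := ?S)"
    let ?t1 = "1 + cost (BranchE (LeftE (Var 2)) (Var 1)) s"
    have e1: "exec (Assign 1 (BranchE (LeftE (Var 2)) (Var 1))) s ?s1 ?t1 []"
      using exec_Assign[of 1 "BranchE (LeftE (Var 2)) (Var 1)" s] F less.prems by simp
    obtain s2 t2 where 2: "exec (update_next c) ?s1 s2 t2 []" "s2 0 = w" "s2 1 = ?S"
      "s2 2 = new w ?S" "t2 \<le> poly r (nodes w + nodes ?S)"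
      using exec_update_next[where new = new and s = ?s1, OF c size] less.prems(1) unfolding r_def by auto
    let ?t3 = "1 + cost (LeftE (Var 1)) s2"
    have e3: "exec (Output (LeftE (Var 1))) s2 s2 ?t3 [(?t3, F)]"
      using exec_Output[of "LeftE (Var 1)" s2] 2(3) by simp
    let ?b = "?t1 + (t2 + ?t3)"
    have body: "exec (enumerate_body c) s s2 ?b [(?b, F)]"
      using exec_Seq[OF e1 exec_Seq[OF 2(1) e3]] unfolding enumerate_body_def
      by (simp add: delay_def)
    have "card (R - set (y # ys)) < card (R - set ys)"
      using F fin by (intro psubset_card_mono) auto
    from less.hyps[where ys = "y # ys" and s = s2 and Fs = "F # Fs", OF this 2(2,3)] obtain s' t os zs where
      IH: "exec (Loop (Var 2) (enumerate_body c)) s2 s' t os" "distinct zs"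
      "set zs = R - set (y # ys)" "list_all2 enc (map snd os) zs"
      "\<And>i. i < length os \<Longrightarrow> output_time os (Suc i) \<le> output_time os i + B (length (y # ys) + i)"
      "t \<le> output_time os (length os) + 3"
      using 2 F less.prems by auto
    let ?T = "1 + cost (Var 2) s + ?b"
    let ?os = "(?T, F) # delay ?T os"
    have "exec (Loop (Var 2) (enumerate_body c)) s s' (?T + t) ?os"
      using exec_LoopTrue[OF _ body IH(1)] F(3) by (simp add: delay_def)
    moreover have "distinct (y # zs)" "set (y # zs) = R - set ys"
      using IH(2,3) F by auto
    moreover have "list_all2 enc (map snd ?os) (y # zs)"
      using IH(4) F by simp
    moreover have "output_time ?os (Suc i) \<le> output_time ?os i + B (length ys + i)"
      if "i < length ?os" for i
    proof (cases i)
      case 0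
      have FN: "nodes F \<le> N"
        using N F by blast
      have len: "length Fs = length ys"
        using less.prems(4) by (rule list_all2_lengthD)
      have "nodes x \<le> N" if "x \<in> set Fs" for x
        using that less.prems(4,6) N by (fastforce simp: list_all2_conv_all_nth in_set_conv_nth)
      then have S: "nodes ?S \<le> 1 + Suc (length ys) * (1 + N)"
        using nodes_data_of_list_le[of "F # Fs" N] FN len by auto
      have t2: "t2 \<le> poly r (nodes w + (1 + Suc (length ys) * (1 + N)))"
        using 2(5) poly_nat_mono[OF add_left_mono[OF S], of r "nodes w"] by (rule order_trans)
      have "?T \<le> 20 + 5 * nodes F + 5 * nodes ?S + t2"
        using F(3) less.prems(2) 2(3) by simp
      also have "\<dots> \<le> 20 + 5 * N + 5 * (1 + Suc (length ys) * (1 + N)) +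
          poly r (nodes w + (1 + Suc (length ys) * (1 + N)))"
        by (intro add_mono mult_le_mono order_refl FN S t2)
      also note B[of "length ys"]
      finally have "?T \<le> B (length ys)" .
      then show ?thesis
        using 0 by (simp add: output_time_def)
    next
      case (Suc j)
      then show ?thesis
        using IH(5)[of j] that by (simp add: output_time_Cons_delay)
    qed
    moreover have "?T + t \<le> output_time ?os (length ?os) + 3"
      using IH(6) by (simp add: output_time_Cons_delay)
    ultimately show ?thesis
      by blast
  qed
qed

text \<open>The reduction of enumeration to a single search: as no solution is larger than the
  input, the list of the first \<open>i\<close> solutions has size polynomial in
  \<open>nodes w + i\<close>, and so has the time of the search for a further one.\<close>

lemma enumerable_if_new:
  assumes "polytime (\<lambda>z. new (left z) (right z))"
    and fin: "\<And>x. x \<in> I \<Longrightarrow> finite (R x)"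
    and size: "\<And>x w F y. x \<in> I \<Longrightarrow> enc_in w x \<Longrightarrow> y \<in> R x \<Longrightarrow> enc_out F y \<Longrightarrow> nodes F \<le> nodes w"
    and new: "\<And>x w Fs ys. x \<in> I \<Longrightarrow> enc_in w x \<Longrightarrow> list_all2 enc_out Fs ys \<Longrightarrow> distinct ys \<Longrightarrow>
      set ys \<subseteq> R x \<Longrightarrow> new w (data_of_list Fs) = Leaf \<and> set ys = R x \<or>
      (\<exists>F. \<exists>y\<in>R x - set ys. new w (data_of_list Fs) = Branch F Leaf \<and> enc_out F y)"
  shows "enumerable_in_incremental_polynomial_time enc_in enc_out R I"
proof -
  obtain p c where p: "\<And>z. nodes (new (left z) (right z)) \<le> poly p (nodes z)"
    and c: "computes c 3 (\<lambda>z. new (left z) (right z)) p"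
    using assms(1) unfolding polytime_def by blast
  define r where "r = [:7, 2:] + 2 * p \<circ>\<^sub>p [:1, 1:]"
  \<comment> \<open>Bounds the size of a list of m + 1 solutions, each of size at most n, in terms
    of n + m.\<close>
  define u :: "nat poly" where "u = [:1:] + [:1, 1:] * [:1, 1:]"
  let ?q = "[:20, 5:] + 5 * u + r \<circ>\<^sub>p ([:0, 1:] + u)"
  \<comment> \<open>The additional summands pay for the preparation, including the first search. If
    there is no solution at all, the whole run fits into them.\<close>
  let ?P = "?q + [:6:] + r \<circ>\<^sub>p [:1, 1:]"
  have run: "\<exists>s' t os ys. exec (enumerate_prog c) (initial_store w) s' t os \<and> distinct ys \<and> set ys = R x \<and>
      list_all2 enc_out (map snd os) ys \<and>
      (\<forall>i<length os. output_time os (Suc i) \<le> output_time os i + poly ?P (nodes w + i)) \<and>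
      t \<le> output_time os (length os) + poly ?P (nodes w)"
    if x: "x \<in> I" and w: "enc_in w x" for x w
  proof -
    let ?s = "initial_store w"
    let ?init = "?s(1 := Leaf)"
    have e0: "exec (Assign 1 LeafE) ?s ?init 3 []"
      using exec_Assign[of 1 LeafE ?s] by (simp add: eval_nat_numeral)
    obtain s1 t1 where 1: "exec (update_next c) ?init s1 t1 []" "s1 0 = w" "s1 1 = Leaf"
      "s1 2 = new w Leaf" "t1 \<le> poly r (nodes w + 1)"
      using exec_update_next[where new = new and s = ?init, OF c p, folded r_def] by (auto simp: initial_store_def)
    have size': "\<forall>y\<in>R x. \<forall>F. enc_out F y \<longrightarrow> nodes F \<le> nodes w"
      using size[OF x w] by blast
    have B: "20 + 5 * nodes w + 5 * (1 + Suc m * (1 + nodes w)) +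
        poly r (nodes w + (1 + Suc m * (1 + nodes w))) \<le> poly ?q (nodes w + m)" for m
    proof -
      define v where "v = 1 + Suc m * (1 + nodes w)"
      have "Suc m * (1 + nodes w) \<le> (1 + (nodes w + m)) * (1 + (nodes w + m))"
        by (intro mult_mono) auto
      then have u: "v \<le> poly u (nodes w + m)"
        by (simp add: u_def v_def)
      have le: "poly r (nodes w + v) \<le>
          poly r ((nodes w + m) + poly u (nodes w + m))"
        using u by (intro poly_nat_mono) linarith
      have q: "poly ?q (nodes w + m) = 20 + 5 * (nodes w + m) + 5 * poly u (nodes w + m) +
          poly r ((nodes w + m) + poly u (nodes w + m))"
        by (simp add: poly_pcompose algebra_simps)
      show ?thesis
        unfolding v_def[symmetric] q
        by (intro add_mono mult_le_mono order_refl le_add1 u le)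
    qed
    obtain s' t os zs where loop: "exec (Loop (Var 2) (enumerate_body c)) s1 s' t os" "distinct zs"
      "set zs = R x" "list_all2 enc_out (map snd os) zs"
      "\<And>i. i < length os \<Longrightarrow> output_time os (Suc i) \<le> output_time os i + poly ?q (nodes w + i)"
      "t \<le> output_time os (length os) + 3"
      using exec_enumerate_loop[where new = new and p = p and c = c and R = "R x" and enc = enc_out and N = "nodes w" and w = w and
          B = "\<lambda>m. poly ?q (nodes w + m)" and s = s1 and Fs = "[]" and ys = "[]",
          folded r_def, OF c p fin[OF x] size' new[OF x w] B] 1 by auto
    let ?T = "3 + t1"
    have run: "exec (enumerate_prog c) ?s s' (?T + t) (delay ?T os)"
      using exec_Seq[OF e0 exec_Seq[OF 1(1) loop(1)]]
      by (simp add: enumerate_prog_def ac_simps)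
    have P: "poly ?P n = poly ?q n + 6 + poly r (n + 1)" for n
      by (simp add: poly_pcompose algebra_simps)
    have gap: "output_time (delay ?T os) (Suc i) \<le> output_time (delay ?T os) i + poly ?P (nodes w + i)"
      if "i < length os" for i
    proof (cases "i = 0")
      case True
      then show ?thesis
        using loop(5)[of 0] that 1(5) output_time_delay[OF Suc_leI[OF that], of ?T] unfolding P
        by (simp add: output_time_def[of _ 0] del: poly_add)
    next
      case False
      then show ?thesis
        using loop(5)[of i] that unfolding P by (simp add: output_time_delay del: poly_add)
    qed
    have "?T + t \<le> output_time (delay ?T os) (length os) + poly ?P (nodes w)"
      using loop(6) 1(5) unfolding P
      by (cases "os = []") (simp_all add: output_time_delay output_time_def[of _ 0] del: poly_add)
    then show ?thesis
      using run loop(2,3,4) gap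
      by (intro exI[of _ s'] exI[of _ "?T + t"] exI[of _ "delay ?T os"] exI[of _ zs])
        (simp del: poly_add)
  qed
  show ?thesis
    unfolding enumerable_in_incremental_polynomial_time_def
    by (intro exI[of _ "enumerate_prog c"] exI[of _ ?P] ballI allI impI run)
qed

section \<open>The search for a new solution\<close>

abbreviation elems :: "data \<Rightarrow> data set" where
  "elems d \<equiv> set (list_of d)"

text \<open>Inclusion and, below, membership are spelled out with quantifiers bounded by lists, so
  that \<open>polytime_pred_Bex\<close> and \<open>polytime_pred_Ball\<close> apply to them
  syntactically.\<close>

abbreviation sub :: "data \<Rightarrow> data \<Rightarrow> bool" where
  "sub a b \<equiv> (\<forall>x\<in>elems a. \<exists>y\<in>elems b. y = x)"

text \<open>One round of forward chaining. Filtering the ground list, instead of appending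
  conclusions to \<open>F\<close>, keeps the result no larger than the input and, if the ground list
  is distinct, free of repetitions.\<close>

definition close_step :: "data \<Rightarrow> data \<Rightarrow> data" where
  "close_step w F = data_of_list (filter (\<lambda>x. (\<exists>y\<in>elems F. y = x) \<or>
    (\<exists>i\<in>elems (left (right w)). sub (left i) F \<and> (\<exists>y\<in>elems (right i). y = x))) (list_of (left w)))"

text \<open>The ground list serves as a counter: a round that changes the set adds an element of the
  ground set, so as many rounds as there are elements suffice.\<close>

definition close :: "data \<Rightarrow> data \<Rightarrow> data" where
  "close w F = foldl (\<lambda>G _. close_step w G) F (list_of (left w))"

definition consistent :: "data \<Rightarrow> data \<Rightarrow> bool" where
  "consistent w F \<longleftrightarrow> (\<forall>e\<in>elems (right (right w)). \<not> sub e (close w F))"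

definition adjoin :: "data \<Rightarrow> data \<Rightarrow> data \<Rightarrow> data" where
  "adjoin w F x = data_of_list (filter (\<lambda>z. z = x \<or> (\<exists>y\<in>elems F. y = z)) (list_of (left w)))"

definition extend_step :: "data \<Rightarrow> data \<Rightarrow> data \<Rightarrow> data" where
  "extend_step w F x = (if consistent w (adjoin w F x) then adjoin w F x else F)"

definition extend :: "data \<Rightarrow> data \<Rightarrow> data" where
  "extend w F = foldl (extend_step w) F (list_of (left w))"

text \<open>The recursion is on the fixed number \<open>m\<close>. Each level offers one more
  element or none, so the list has length (|X| + 1)^m, polynomial in the input.\<close>

primrec small_candidates :: "nat \<Rightarrow> data \<Rightarrow> data list" where
  "small_candidates 0 w = [Leaf]"
| "small_candidates (Suc m) w =
    concat (map (\<lambda>Y. Y # map (\<lambda>x. adjoin w Y x) (list_of (left w))) (small_candidates m w))"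

text \<open>All \<open>m\<close>-fold intersections of sets \<open>insert x F\<close> within the
  ground set, one factor per level. The right pairs of \<open>F\<close> and \<open>x\<close> are not
  known in advance, so all of them are tried, which makes (|S| |X|)^m intersections.\<close>

primrec large_candidates :: "nat \<Rightarrow> data \<Rightarrow> data \<Rightarrow> data list" where
  "large_candidates 0 w S = [left w]"
| "large_candidates (Suc m) w S =
    concat (map (\<lambda>J. concat (map (\<lambda>F. map (\<lambda>x.
      data_of_list (filter (\<lambda>z. z = x \<or> (\<exists>y\<in>elems F. y = z)) (list_of J)))
      (list_of (left w))) (list_of S))) (large_candidates m w S))"

definition candidates :: "nat \<Rightarrow> data \<Rightarrow> data \<Rightarrow> data list" where
  "candidates d w S = filter (\<lambda>J. consistent w J \<and> \<not> (\<exists>F\<in>elems S. sub J F))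
    (small_candidates d w @ large_candidates (Suc d) w S)"

text \<open>The result is wrapped in a \<open>Branch\<close> since the empty set, a possible
  solution, is itself encoded by \<open>Leaf\<close> and would be mistaken for the end of the
  enumeration.\<close>

definition new_solution :: "nat \<Rightarrow> data \<Rightarrow> data \<Rightarrow> data" where
  "new_solution d w S =
    (if data_of_list (candidates d w S) = Leaf then Leaf
     else Branch (extend w (left (data_of_list (candidates d w S)))) Leaf)"

lemma nodes_filter_list_of: "nodes (data_of_list (filter P (list_of d))) \<le> nodes d"
  using nodes_filter[of P "list_of d"] by simp

section \<open>Running time of the search\<close>

lemma polytime_close_step: "polytime (\<lambda>z. close_step (left z) (right z))"
  unfolding close_step_def by (intro polytime_intros)

lemma polytime_close: "polytime (\<lambda>z. close (left z) (right z))"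
proof -
  have "polytime (\<lambda>z. foldl (\<lambda>G _. close_step (left z) G) (right z) (list_of (left (left z))))"
  \<comment> \<open>The result of a step is a sublist of the ground list, whatever the accumulator,
    so the size of the environment bounds it.\<close>
  proof (rule polytime_foldl[where q = "[:0, 1:]"])
    fix e acc x
    show "nodes (close_step (left e) acc) \<le> nodes acc + poly [:0, 1:] (nodes e + nodes x)"
      using nodes_filter_list_of[of _ "left (left e)"] nodes_left[of e] nodes_left[of "left e"]
      by (fastforce simp: close_step_def intro: order_trans)
  qed (intro polytime_comp2[OF polytime_close_step] polytime_intros)+
  then show ?thesis
    by (simp add: close_def)
qed

lemma polytime_consistent: "polytime_pred (\<lambda>z. consistent (left z) (right z))"
  unfolding consistent_def
  by (intro polytime_intros polytime_comp2[OF polytime_close])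

lemma polytime_adjoin:
  assumes "polytime f" "polytime g" "polytime h"
  shows "polytime (\<lambda>z. adjoin (f z) (g z) (h z))"
proof -
  have "polytime (\<lambda>z. adjoin (left z) (left (right z)) (right (right z)))"
    unfolding adjoin_def by (intro polytime_intros)
  from polytime_comp[OF this, of "\<lambda>z. Branch (f z) (Branch (g z) (h z))"] show ?thesis
    by (simp add: polytime_Branch assms)
qed

lemma polytime_pred_comp2:
  assumes "polytime_pred (\<lambda>x. P (left x) (right x))" "polytime g" "polytime h"
  shows "polytime_pred (\<lambda>x. P (g x) (h x))"
  using assms polytime_comp2[of "\<lambda>x y. truth (P x y)"] unfolding polytime_pred_def by blast

lemma polytime_extend: "polytime (\<lambda>z. extend (left z) (right z))"
proof -
  have "polytime (\<lambda>z. foldl (extend_step (left z)) (right z) (list_of (left (left z))))"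
  proof (rule polytime_foldl[where q = "[:0, 1:]"])
    fix e acc x
    have "nodes (adjoin (left e) acc x) \<le> nodes e"
      using nodes_filter_list_of[of _ "left (left e)"] nodes_left[of e] nodes_left[of "left e"]
      by (fastforce simp: adjoin_def intro: order_trans)
    then show "nodes (extend_step (left e) acc x) \<le> nodes acc + poly [:0, 1:] (nodes e + nodes x)"
      by (simp add: extend_step_def)
  next
    show "polytime (\<lambda>z. extend_step (left (left z)) (left (right z)) (right (right z)))"
      unfolding extend_step_def
      by (intro polytime_intros polytime_adjoin polytime_pred_comp2[OF polytime_consistent])
  qed (intro polytime_intros)+
  then show ?thesis
    by (simp add: extend_def)
qed

lemma polytime_list_comp: "polytime_list f \<Longrightarrow> polytime g \<Longrightarrow> polytime_list (\<lambda>z. f (g z))"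
  unfolding polytime_list_def by (rule polytime_comp)

text \<open>The induction on \<open>m\<close> takes place outside the programs: each
  \<open>m\<close> has a program of its own, with its own nesting of loops and its own
  polynomial.\<close>

lemma polytime_small_candidates: "polytime_list (small_candidates m)"
proof (induction m)
  case 0
  show ?case
    unfolding small_candidates.simps by (intro polytime_intros)
next
  case (Suc m)
  show ?case
    unfolding small_candidates.simps by (intro polytime_intros polytime_adjoin Suc)
qed

lemma polytime_large_candidates: "polytime_list (\<lambda>z. large_candidates m (left z) (right z))"
proof (induction m)
  case 0
  show ?case
    unfolding large_candidates.simps by (intro polytime_intros)
next
  case (Suc m)
  show ?case
    unfolding large_candidates.simps by (intro polytime_intros Suc)
qed

lemma polytime_new_solution: "polytime (\<lambda>z. new_solution d (left z) (right z))"
proof -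
  have "polytime_list (\<lambda>z. candidates d (left z) (right z))"
    unfolding candidates_def
    by (intro polytime_intros polytime_list_comp[OF polytime_small_candidates]
      polytime_large_candidates polytime_pred_comp2[OF polytime_consistent])
  then show ?thesis
    unfolding new_solution_def
    by (intro polytime_intros polytime_comp2[OF polytime_extend])
qed

section \<open>Closure, consistency and maximal consistent sets\<close>

abbreviation cl :: "'a set \<Rightarrow> ('a set \<times> 'a set) set \<Rightarrow> 'a set \<Rightarrow> 'a set" where
  "cl X \<Sigma> Y \<equiv> (\<lambda>F. F \<in> closure_system X \<Sigma>) hull Y"

text \<open>Consistency is stated for arbitrary sets, closed or not, because this yields a family
  closed under subsets; its maximal members within the ground set are the solutions.\<close>

fun consistent_set :: "'a mcc_input \<Rightarrow> 'a set \<Rightarrow> bool" where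
  "consistent_set (X, \<Sigma>, E) Y \<longleftrightarrow> independent_set E (cl X \<Sigma> Y)"

declare consistent_set.simps [simp del]

lemma ground_in_closure_system: "implicational_base X \<Sigma> \<Longrightarrow> X \<in> closure_system X \<Sigma>"
  by (auto simp: closure_system_def implicational_base_def satisfies_def)

text \<open>Closed sets are stable under intersection. Since \<open>X\<close> is a closed set
  containing \<open>Y\<close>, the intersection is not over the empty family, which would give
  \<open>UNIV\<close>.\<close>

lemma cl_in_closure_system:
  assumes "implicational_base X \<Sigma>" "Y \<subseteq> X"
  shows "cl X \<Sigma> Y \<in> closure_system X \<Sigma>"
proof -
  have "cl X \<Sigma> Y \<subseteq> X"
    using ground_in_closure_system[OF assms(1)] assms(2) by (intro hull_minimal)
  moreover have "satisfies (cl X \<Sigma> Y) \<Sigma>"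
    unfolding satisfies_def hull_def
  proof (clarify intro!: Inter_greatest)
    fix A B x F
    assume "(A, B) \<in> \<Sigma>" "A \<subseteq> \<Inter>{F. F \<in> closure_system X \<Sigma> \<and> Y \<subseteq> F}" "x \<in> B"
      "F \<in> closure_system X \<Sigma>" "Y \<subseteq> F"
    then show "x \<in> F"
      unfolding closure_system_def satisfies_def by blast
  qed
  ultimately show ?thesis
    by (simp add: closure_system_def)
qed

lemma consistent_set_mono: "consistent_set x Z \<Longrightarrow> Y \<subseteq> Z \<Longrightarrow> consistent_set x Y"
proof (cases x)
  case (fields X \<Sigma> E)
  assume "consistent_set x Z" "Y \<subseteq> Z"
  then show ?thesis
    using hull_mono[of Y Z "\<lambda>F. F \<in> closure_system X \<Sigma>"] fields
    unfolding independent_set_def by (auto simp: consistent_set.simps independent_set_def)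
qed

lemma maxCC_consistent: "F \<in> maxCC (X, \<Sigma>, E) \<Longrightarrow> F \<subseteq> X \<and> consistent_set (X, \<Sigma>, E) F"
  by (auto simp: Let_def hull_same consistent_set.simps) (auto simp: closure_system_def)

text \<open>Maximality against single elements is enough: if a closed independent set above
  \<open>G\<close> contains \<open>x\<close>, it also contains the closure of
  \<open>insert x G\<close>, which is then independent. Applied to the closure of \<open>G\<close>,
  this shows in particular that \<open>G\<close> is closed.\<close>

lemma maxCC_if_maximal:
  assumes "implicational_base X \<Sigma>" "G \<subseteq> X" "consistent_set (X, \<Sigma>, E) G"
    and max: "\<And>x. x \<in> X \<Longrightarrow> consistent_set (X, \<Sigma>, E) (insert x G) \<Longrightarrow> x \<in> G"
  shows "G \<in> maxCC (X, \<Sigma>, E)"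
proof -
  have absorb: "F \<subseteq> G" if F: "F \<in> closure_system X \<Sigma>" "independent_set E F" "G \<subseteq> F" for F
  proof
    fix x assume "x \<in> F"
    then have "cl X \<Sigma> (insert x G) \<subseteq> F"
      using F by (intro hull_minimal) auto
    then have "consistent_set (X, \<Sigma>, E) (insert x G)"
      using F(2) unfolding consistent_set.simps independent_set_def by blast
    then show "x \<in> G"
      using \<open>x \<in> F\<close> F(1) by (intro max) (auto simp: closure_system_def)
  qed
  have "cl X \<Sigma> G = G"
    using absorb[OF cl_in_closure_system[OF assms(1,2)]] assms(3) hull_subset[of G]
    by (simp add: consistent_set.simps subset_antisym)
  then have "G \<in> closure_system X \<Sigma>" "independent_set E G"
    using cl_in_closure_system[OF assms(1,2)] assms(3) by (auto simp: consistent_set.simps)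
  then show ?thesis
    using absorb by (auto simp: Let_def)
qed

text \<open>
  A minimal set \<open>I \<subseteq> T\<close> within no member of \<open>\<S>\<close> is either small or contains \<open>d + 1\<close> elements \<open>y\<close> such
  that \<open>I - {y}\<close> lies within some member \<open>F\<close> of \<open>\<S>\<close>. In the second case the intersection of the sets
  \<open>insert y F\<close> is consistent, because a \<open>d\<close>-subset of it misses some \<open>y\<close> and so lies in the
  corresponding \<open>F\<close>.
\<close>

lemma candidate_exists:
  assumes "finite X" "T \<subseteq> X" "consistent_set x T" and T: "\<And>F. F \<in> \<S> \<Longrightarrow> \<not> T \<subseteq> F"
    and S: "\<And>F. F \<in> \<S> \<Longrightarrow> consistent_set x F"
    and local: "\<And>Y. Y \<subseteq> X \<Longrightarrow> (\<And>Z. Z \<subseteq> Y \<Longrightarrow> card Z \<le> d \<Longrightarrow> consistent_set x Z) \<Longrightarrow> consistent_set x Y"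
  shows "(\<exists>Z\<subseteq>X. card Z \<le> d \<and> consistent_set x Z \<and> (\<forall>F\<in>\<S>. \<not> Z \<subseteq> F)) \<or>
    (\<exists>ps. length ps = Suc d \<and> set ps \<subseteq> \<S> \<times> X \<and>
      consistent_set x (X \<inter> (\<Inter>(F, y)\<in>set ps. insert y F)) \<and>
      (\<forall>F\<in>\<S>. \<not> X \<inter> (\<Inter>(F, y)\<in>set ps. insert y F) \<subseteq> F))"
proof -
  let ?A = "{I. I \<subseteq> T \<and> (\<forall>F\<in>\<S>. \<not> I \<subseteq> F)}"
  have finT: "finite T"
    using assms(1,2) by (rule finite_subset[rotated])
  have fin: "finite ?A"
    by (rule finite_subset[of _ "Pow T"]) (auto simp: finT)
  have "?A \<noteq> {}"
    using T by blast
  from finite_has_minimal[OF fin this] obtain I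
    where IA: "I \<in> ?A" and min: "\<forall>J\<in>?A. J \<subseteq> I \<longrightarrow> I = J"
    by (rule bexE)
  have I: "I \<subseteq> T" "\<And>F. F \<in> \<S> \<Longrightarrow> \<not> I \<subseteq> F"
    using IA by simp_all
  have minimal: "\<exists>F\<in>\<S>. J \<subseteq> F" if "J \<subset> I" for J
  proof (rule ccontr)
    assume "\<not> (\<exists>F\<in>\<S>. J \<subseteq> F)"
    then have "J \<in> ?A"
      using that I(1) by simp
    then have "I = J"
      using min that psubset_imp_subset by blast
    then show False
      using that by simp
  qed
  show ?thesis
  proof (cases "card I \<le> d")
    case True
    then show ?thesis
      using I assms(2) consistent_set_mono[OF assms(3) I(1)]
      by (intro disjI1 exI[of _ I] conjI ballI subset_trans[OF I(1)])
  next
    case False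
    then obtain Y where Y: "Y \<subseteq> I" "card Y = Suc d"
      using obtain_subset_with_card_n[of "Suc d" I] by auto
    then obtain ys where ys: "set ys = Y" "distinct ys"
      using finite_distinct_list[of Y] finite_subset[OF _ finT, of Y] I(1) by auto
    have "\<exists>F\<in>\<S>. I - {y} \<subseteq> F" if "y \<in> Y" for y
      using minimal[of "I - {y}"] that Y(1) by blast
    then obtain f where f: "\<And>y. y \<in> Y \<Longrightarrow> f y \<in> \<S>" "\<And>y. y \<in> Y \<Longrightarrow> I - {y} \<subseteq> f y"
      by metis
    let ?J = "X \<inter> (\<Inter>y\<in>Y. insert y (f y))"
    have con: "consistent_set x ?J"
    proof (rule local)
      fix Z assume Z: "Z \<subseteq> ?J" "card Z \<le> d"
      have "finite Z"
        by (rule finite_subset[OF Z(1)]) (simp add: assms(1))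
      then have "\<not> Y \<subseteq> Z"
        using Y(2) card_mono[of Z Y] Z(2) by linarith
      then obtain y where y: "y \<in> Y" "y \<notin> Z"
        by blast
      then have "Z \<subseteq> f y"
        using Z(1) by auto
      then show "consistent_set x Z"
        using S[OF f(1)[OF y(1)]] by (rule consistent_set_mono[rotated])
    qed simp
    \<comment> \<open>From \<open>I - {y} \<subseteq> f y\<close> follows
      \<open>I \<subseteq> insert y (f y)\<close>. So \<open>?J\<close> inherits from
      \<open>I\<close> that no member of \<open>\<S>\<close> contains it.\<close>
    have IJ: "I \<subseteq> ?J"
      using f(2) subset_trans[OF I(1) assms(2)] by auto
    have new: "\<forall>F\<in>\<S>. \<not> ?J \<subseteq> F"
      using I(2) subset_trans[OF IJ] by blast
    let ?ps = "map (\<lambda>y. (f y, y)) ys"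
    have J: "X \<inter> (\<Inter>(F, y)\<in>set ?ps. insert y F) = ?J"
      using ys(1) by auto
    have "length ?ps = Suc d"
      using Y(2) ys distinct_card[of ys] by simp
    moreover have "set ?ps \<subseteq> \<S> \<times> X"
      using f(1) subset_trans[OF Y(1) subset_trans[OF I(1) assms(2)]] ys(1) by auto
    ultimately have "length ?ps = Suc d \<and> set ?ps \<subseteq> \<S> \<times> X \<and>
        consistent_set x (X \<inter> (\<Inter>(F, y)\<in>set ?ps. insert y F)) \<and>
        (\<forall>F\<in>\<S>. \<not> X \<inter> (\<Inter>(F, y)\<in>set ?ps. insert y F) \<subseteq> F)"
      unfolding J using con new by simp
    then show ?thesis
      by (intro disjI2 exI)
  qed
qed

text \<open>As long as the iterates change they gain at least one element per round. After
  \<open>card X\<close> rounds the set is therefore stable or all of \<open>X\<close>, and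
  \<open>X\<close> is stable as well.\<close>

lemma funpow_stable:
  assumes "finite X" "Y \<subseteq> X" "\<And>Z. Z \<subseteq> X \<Longrightarrow> Z \<subseteq> h Z \<and> h Z \<subseteq> X"
  shows "h ((h ^^ card X) Y) = (h ^^ card X) Y"
proof -
  have sub: "(h ^^ n) Y \<subseteq> X" for n
    using assms(2,3) by (induction n) auto
  have "h ((h ^^ n) Y) = (h ^^ n) Y \<or> n \<le> card ((h ^^ n) Y)" for n
  proof (induction n)
    case (Suc n)
    show ?case
    proof (cases "h ((h ^^ n) Y) = (h ^^ n) Y")
      case False
      then have "(h ^^ n) Y \<subset> h ((h ^^ n) Y)"
        using assms(3)[OF sub[of n]] by auto
      then have "card ((h ^^ n) Y) < card (h ((h ^^ n) Y))"
        using finite_subset[OF sub[of "Suc n"] assms(1)] by (simp add: psubset_card_mono)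
      then show ?thesis
        using Suc False by auto
    qed simp
  qed simp
  from this[of "card X"] show ?thesis
    using card_seteq[OF assms(1) sub] assms(3)[of X] by force
qed

section \<open>Encoded instances and correctness of the search\<close>

lemma enc_set_eq: "enc_set (=) d S \<longleftrightarrow> distinct (list_of d) \<and> elems d = S"
proof
  assume "enc_set (=) d S"
  then show "distinct (list_of d) \<and> elems d = S"
    by (auto simp: enc_set_def list.rel_eq)
next
  assume "distinct (list_of d) \<and> elems d = S"
  then show "enc_set (=) d S"
    unfolding enc_set_def by (intro exI[of _ "list_of d"]) (simp add: list.rel_eq)
qed

lemma enc_set_image: "enc_set enc d S \<Longrightarrow> (\<And>a y. enc a y \<Longrightarrow> y = f a) \<Longrightarrow> S = f ` elems d"
proof -
  assume "enc_set enc d S" and f: "\<And>a y. enc a y \<Longrightarrow> y = f a"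
  then obtain xs ds where xs: "set xs = S" "list_all2 enc ds xs" "d = data_of_list ds"
    unfolding enc_set_def by blast
  have "xs = map f ds"
    using xs(2) by (induction rule: list_all2_induct) (auto dest: f)
  then show ?thesis
    using xs by auto
qed

lemma enc_instance_dest:
  assumes "enc_instance w (X, \<Sigma>, E)"
  shows "distinct (list_of (left w))" "elems (left w) = X"
    "\<Sigma> = (\<lambda>i. (elems (left i), elems (right i))) ` elems (left (right w))"
    "E = elems ` elems (right (right w))"
proof -
  obtain a b c where w: "w = Branch a (Branch b c)" "enc_set (=) a X"
    "enc_set (enc_pair (enc_set (=)) (enc_set (=))) b \<Sigma>" "enc_set (enc_set (=)) c E"
    using assms by (auto simp: enc_instance_def enc_pair_def)
  show "distinct (list_of (left w))" "elems (left w) = X"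
    using w(1,2) by (auto simp: enc_set_eq)
  have "y = (elems (left a), elems (right a))" if "enc_pair (enc_set (=)) (enc_set (=)) a y" for a y
    using that by (cases y) (auto simp: enc_pair_def enc_set_eq)
  from enc_set_image[OF w(3) this]
  show "\<Sigma> = (\<lambda>i. (elems (left i), elems (right i))) ` elems (left (right w))"
    using w(1) by simp
  show "E = elems ` elems (right (right w))"
    using enc_set_image[OF w(4), of elems] w(1) by (auto simp: enc_set_eq)
qed

text \<open>Without repetitions the size is a sum over the set of elements, independent of their
  order. Thus every encoding of a subset of the ground set, in whichever order, is bounded by the
  ground list.\<close>

lemma nodes_distinct:
  assumes "distinct (list_of d)" "elems d \<subseteq> elems e"
  shows "nodes d \<le> nodes e"
proof -
  have "nodes d = 1 + (\<Sum>x\<in>elems d. 1 + nodes x)"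
    using nodes_data_of_list[of "list_of d"] assms(1) by (simp add: sum_list_distinct_conv_sum_set)
  also have "\<dots> \<le> 1 + (\<Sum>x\<in>elems e. 1 + nodes x)"
    using assms(2) by (intro add_left_mono sum_mono2) auto
  also have "(\<Sum>x\<in>elems e. 1 + nodes x) \<le> (\<Sum>x\<leftarrow>list_of e. 1 + nodes x)"
    by (induction e) (auto simp: sum.insert_if)
  also have "1 + \<dots> = nodes e"
    using nodes_data_of_list[of "list_of e"] by simp
  finally show ?thesis
    by simp
qed

lemma sub_iff: "sub a b \<longleftrightarrow> elems a \<subseteq> elems b"
  by auto

lemma foldl_const: "foldl (\<lambda>G _. h G) F xs = (h ^^ length xs) F"
  by (induction xs arbitrary: F) (auto simp: funpow_swap1)

text \<open>The iteration ends in a fixed point of one round of forward chaining, which is closed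
  and hence contains the closure; conversely no round leaves a closed set containing the
  start.\<close>

lemma elems_close:
  assumes enc: "enc_instance w (X, \<Sigma>, E)" and X: "finite X" and \<Sigma>: "implicational_base X \<Sigma>"
    and F: "elems F \<subseteq> X"
  shows "elems (close w F) = cl X \<Sigma> (elems F)"
proof -
  note w = enc_instance_dest[OF enc]
  define h where "h Y = {x \<in> X. x \<in> Y \<or> (\<exists>(A, B)\<in>\<Sigma>. A \<subseteq> Y \<and> x \<in> B)}" for Y
  have step: "elems (close_step w G) = h (elems G)" for G
    using w by (auto simp: close_step_def h_def sub_iff)
  have "elems ((close_step w ^^ n) G) = (h ^^ n) (elems G)" for n G
    by (induction n) (auto simp: step)
  moreover have "length (list_of (left w)) = card X"
    using w(1,2) distinct_card by fastforce
  ultimately have close: "elems (close w F) = (h ^^ card X) (elems F)"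
    by (simp add: close_def foldl_const)
  have h: "Z \<subseteq> h Z \<and> h Z \<subseteq> X" if "Z \<subseteq> X" for Z
    using that by (auto simp: h_def)
  have iter: "elems F \<subseteq> (h ^^ n) (elems F) \<and> (h ^^ n) (elems F) \<subseteq> X" for n
  proof (induction n)
    case (Suc n)
    then show ?case
      using h[of "(h ^^ n) (elems F)"] by auto
  qed (simp add: F)
  have "h (elems (close w F)) = elems (close w F)"
    unfolding close using funpow_stable[OF X F h] .
  \<comment> \<open>Conclusions lie in \<open>X\<close>, so the restriction of \<open>h\<close> to
    \<open>X\<close> loses none of them.\<close>
  then have "satisfies (elems (close w F)) \<Sigma>"
    using \<Sigma> unfolding satisfies_def implicational_base_def h_def by blast
  then have "cl X \<Sigma> (elems F) \<subseteq> elems (close w F)"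
    using iter[of "card X"] by (intro hull_minimal) (auto simp: close closure_system_def)
  moreover have "(h ^^ n) (elems F) \<subseteq> G" if "elems F \<subseteq> G" "G \<in> closure_system X \<Sigma>" for n G
  proof (induction n)
    case (Suc n)
    have "h ((h ^^ n) (elems F)) \<subseteq> G"
      using Suc that(2) unfolding h_def closure_system_def satisfies_def by blast
    then show ?case
      by simp
  qed (simp add: that)
  then have "elems (close w F) \<subseteq> cl X \<Sigma> (elems F)"
    unfolding hull_def close by blast
  ultimately show ?thesis
    by blast
qed

lemma consistent_iff:
  assumes "enc_instance w (X, \<Sigma>, E)" "finite X" "implicational_base X \<Sigma>" "elems F \<subseteq> X"
  shows "consistent w F \<longleftrightarrow> consistent_set (X, \<Sigma>, E) (elems F)"
proof -
  have "consistent w F \<longleftrightarrow> (\<forall>e\<in>elems (right (right w)). \<not> elems e \<subseteq> cl X \<Sigma> (elems F))"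
    unfolding consistent_def sub_iff unfolding elems_close[OF assms] ..
  also have "\<dots> \<longleftrightarrow> consistent_set (X, \<Sigma>, E) (elems F)"
    unfolding consistent_set.simps independent_set_def enc_instance_dest(4)[OF assms(1)] by simp
  finally show ?thesis .
qed

lemma elems_adjoin: "elems (adjoin w F x) = elems (left w) \<inter> insert x (elems F)"
  by (auto simp: adjoin_def)

lemma distinct_adjoin: "distinct (list_of (left w)) \<Longrightarrow> distinct (list_of (adjoin w F x))"
  by (simp add: adjoin_def)

text \<open>A rejection remains justified although the set grows later: if \<open>x\<close> could be
  added consistently to the final set, it could have been added to the smaller set against which it
  was tested. One pass over the elements thus reaches a maximal set.\<close>

lemma foldl_extend_step:
  assumes enc: "enc_instance w (X, \<Sigma>, E)" and X: "finite X" and \<Sigma>: "implicational_base X \<Sigma>"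
    and "elems F \<subseteq> X" "consistent_set (X, \<Sigma>, E) (elems F)" "distinct (list_of F)" "set xs \<subseteq> X"
  defines "G \<equiv> foldl (extend_step w) F xs"
  shows "elems F \<subseteq> elems G \<and> elems G \<subseteq> X \<and> consistent_set (X, \<Sigma>, E) (elems G) \<and> distinct (list_of G) \<and>
    (\<forall>x\<in>set xs. consistent_set (X, \<Sigma>, E) (insert x (elems G)) \<longrightarrow> x \<in> elems G)"
  using assms(4-7) unfolding G_def
proof (induction xs arbitrary: F)
  case (Cons x xs)
  note w = enc_instance_dest[OF enc]
  let ?F = "extend_step w F x"
  let ?G = "foldl (extend_step w) ?F xs"
  have adj: "elems (adjoin w F x) = insert x (elems F)"
    using Cons.prems w(2) by (auto simp: elems_adjoin)
  have iff: "consistent w (adjoin w F x) \<longleftrightarrow> consistent_set (X, \<Sigma>, E) (insert x (elems F))"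
    using consistent_iff[OF enc X \<Sigma>, of "adjoin w F x"] Cons.prems adj by auto
  have F: "elems F \<subseteq> elems ?F" "elems ?F \<subseteq> X" "consistent_set (X, \<Sigma>, E) (elems ?F)" "distinct (list_of ?F)"
    "consistent_set (X, \<Sigma>, E) (insert x (elems F)) \<Longrightarrow> x \<in> elems ?F"
    using Cons.prems adj iff distinct_adjoin[OF w(1)] by (auto simp: extend_step_def)
  have G: "elems ?F \<subseteq> elems ?G" "elems ?G \<subseteq> X" "consistent_set (X, \<Sigma>, E) (elems ?G)" "distinct (list_of ?G)"
    "\<forall>x\<in>set xs. consistent_set (X, \<Sigma>, E) (insert x (elems ?G)) \<longrightarrow> x \<in> elems ?G"
    using Cons.IH[OF F(2-4)] Cons.prems(4) by auto
  moreover have "x \<in> elems ?G" if "consistent_set (X, \<Sigma>, E) (insert x (elems ?G))"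
    using consistent_set_mono[OF that, of "insert x (elems F)"] F(1,5) G(1) by blast
  ultimately show ?case
    using F(1) by auto
qed simp

lemma extend:
  assumes "enc_instance w (X, \<Sigma>, E)" "finite X" "implicational_base X \<Sigma>"
    and "elems F \<subseteq> X" "consistent_set (X, \<Sigma>, E) (elems F)" "distinct (list_of F)"
  shows "elems F \<subseteq> elems (extend w F)" "elems (extend w F) \<in> maxCC (X, \<Sigma>, E)"
    "distinct (list_of (extend w F))"
proof -
  note G = foldl_extend_step[OF assms, of "list_of (left w)", folded extend_def]
  have X: "elems (left w) = X"
    using enc_instance_dest[OF assms(1)] by simp
  show "elems F \<subseteq> elems (extend w F)" "distinct (list_of (extend w F))"
    using G X by auto
  show "elems (extend w F) \<in> maxCC (X, \<Sigma>, E)"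
    using G X by (intro maxCC_if_maximal assms(3)) auto
qed

text \<open>If nothing can be adjoined to a candidate, \<open>extend\<close> returns its list as it
  is, so the list must already be free of repetitions to be an admissible output.\<close>

lemma small_candidates_sound:
  assumes "distinct (list_of (left w))" "J \<in> set (small_candidates m w)"
  shows "elems J \<subseteq> elems (left w) \<and> distinct (list_of J)"
  using assms(2)
  by (induction m arbitrary: J) (auto simp: elems_adjoin distinct_adjoin[OF assms(1)])

lemma large_candidates_sound:
  assumes "distinct (list_of (left w))" "J \<in> set (large_candidates m w S)"
  shows "elems J \<subseteq> elems (left w) \<and> distinct (list_of J)"
  using assms(2)
proof (induction m arbitrary: J)
  case (Suc m)
  from Suc.prems obtain J' Q where "J' \<in> set (large_candidates m w S)"
    "J = data_of_list (filter Q (list_of J'))"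
    by auto
  then show ?case
    using Suc.IH[of J'] by auto
qed (simp add: assms(1))

lemma small_candidates_complete:
  assumes "Z \<subseteq> elems (left w)" "card Z \<le> m"
  shows "Z \<in> elems ` set (small_candidates m w)"
  using assms
proof (induction m arbitrary: Z)
  case 0
  then show ?case
    using finite_subset[OF 0(1)] by auto
next
  case (Suc m)
  show ?case
  proof (cases "card Z \<le> m")
    case True
    then obtain J where "J \<in> set (small_candidates m w)" "elems J = Z"
      using Suc.IH[of Z] Suc.prems(1) by auto
    then show ?thesis
      by (intro image_eqI[of _ _ J]) auto
  next
    case False
    then have "card Z = Suc m"
      using Suc.prems(2) by simp
    then obtain x Y where x: "Z = insert x Y" "x \<notin> Y" "card Y \<le> m"
      by (metis card_Suc_eq order_refl)
    then obtain J where J: "J \<in> set (small_candidates m w)" "elems J = Y"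
      using Suc.IH[of Y] Suc.prems(1) by auto
    then have "elems (adjoin w J x) = Z"
      using x Suc.prems(1) by (auto simp: elems_adjoin)
    moreover have "adjoin w J x \<in> set (small_candidates (Suc m) w)"
      using J(1) x(1) Suc.prems(1) by auto
    ultimately show ?thesis
      by blast
  qed
qed

lemma large_candidates_complete:
  assumes "length ps = m" "set ps \<subseteq> elems ` elems S \<times> elems (left w)"
  shows "elems (left w) \<inter> (\<Inter>(F, y)\<in>set ps. insert y F) \<in> elems ` set (large_candidates m w S)"
  using assms
proof (induction m arbitrary: ps)
  case (Suc m)
  then obtain F y qs where ps: "ps = (elems F, y) # qs" "F \<in> elems S" "y \<in> elems (left w)"
    "length qs = m" "set qs \<subseteq> elems ` elems S \<times> elems (left w)"
    by (cases ps) auto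
  obtain J where J: "J \<in> set (large_candidates m w S)"
    "elems J = elems (left w) \<inter> (\<Inter>(F, y)\<in>set qs. insert y F)"
    using Suc.IH[OF ps(4,5)] by auto
  let ?J = "data_of_list (filter (\<lambda>z. z = y \<or> (\<exists>x\<in>elems F. x = z)) (list_of J))"
  have "?J \<in> set (large_candidates (Suc m) w S)"
    using J(1) ps(2,3) by (simp, intro bexI[of _ J] rev_bexI[of F] imageI)
  moreover have "elems ?J = elems (left w) \<inter> (\<Inter>(F, y)\<in>set ps. insert y F)"
    using J(2) ps(1) by auto
  ultimately show ?case
    by blast
qed simp

text \<open>Extending a candidate gives a new solution since a set above one that no known solution
  contains cannot itself be known. If there is no candidate, a missing solution \<open>T\<close>
  would contradict \<open>candidate_exists\<close>. The hypothesis \<open>local\<close> is all that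
  is asked of the closure system.\<close>

lemma new_solution_correct:
  assumes enc: "enc_instance w (X, \<Sigma>, E)" and X: "finite X" and \<Sigma>: "implicational_base X \<Sigma>"
    and local: "\<And>Y. Y \<subseteq> X \<Longrightarrow> (\<And>Z. Z \<subseteq> Y \<Longrightarrow> card Z \<le> d \<Longrightarrow> consistent_set (X, \<Sigma>, E) Z) \<Longrightarrow> consistent_set (X, \<Sigma>, E) Y"
    and Fs: "list_all2 (enc_set (=)) Fs ys" "distinct ys" "set ys \<subseteq> maxCC (X, \<Sigma>, E)"
  defines "N \<equiv> new_solution d w (data_of_list Fs)"
  shows "N = Leaf \<and> set ys = maxCC (X, \<Sigma>, E) \<or>
    (\<exists>F. \<exists>y\<in>maxCC (X, \<Sigma>, E) - set ys. N = Branch F Leaf \<and> enc_set (=) F y)"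
proof -
  note w = enc_instance_dest[OF enc]
  let ?S = "data_of_list Fs"
  let ?c = "candidates d w ?S"
  have ys: "set ys = elems ` elems ?S"
    using Fs(1) by (induction rule: list_all2_induct) (auto simp: enc_set_eq)
  have sound: "elems J \<subseteq> X \<and> distinct (list_of J) \<and> consistent_set (X, \<Sigma>, E) (elems J) \<and>
      (\<forall>F\<in>set ys. \<not> elems J \<subseteq> F)" if "J \<in> set ?c" for J
  proof -
    have J: "J \<in> set (small_candidates d w @ large_candidates (Suc d) w ?S)" "consistent w J"
      "\<not> (\<exists>F\<in>elems ?S. sub J F)"
      using that unfolding candidates_def by auto
    have "elems J \<subseteq> X \<and> distinct (list_of J)"
      using J(1) small_candidates_sound[OF w(1), of J d] large_candidates_sound[OF w(1), of J "Suc d" ?S]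
      unfolding w(2) set_append by blast
    then show ?thesis
      using J(2,3) consistent_iff[OF enc X \<Sigma>, of J] unfolding sub_iff ys by simp
  qed
  show ?thesis
  proof (cases ?c)
    case Nil
    have "set ys = maxCC (X, \<Sigma>, E)"
    proof (rule ccontr)
      assume "set ys \<noteq> maxCC (X, \<Sigma>, E)"
      then obtain T where T: "T \<in> maxCC (X, \<Sigma>, E)" "T \<notin> set ys"
        using Fs(3) by blast
      have cand: False if "J \<in> set (small_candidates d w @ large_candidates (Suc d) w ?S)"
        "consistent_set (X, \<Sigma>, E) (elems J)" "elems J \<subseteq> X" "\<forall>F\<in>set ys. \<not> elems J \<subseteq> F" for J
      proof -
        have "J \<in> set ?c"
          using that consistent_iff[OF enc X \<Sigma>, of J]
          unfolding candidates_def sub_iff ys by (simp del: large_candidates.simps)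
        then show False
          using Nil by simp
      qed
      \<comment> \<open>Two different solutions are incomparable, by maximality.\<close>
      have max: "\<not> T \<subseteq> F" if "F \<in> set ys" for F
        using T Fs(3) that by (auto simp: Let_def)
      note TX = maxCC_consistent[OF T(1), THEN conjunct1] maxCC_consistent[OF T(1), THEN conjunct2]
      have "(\<exists>Z\<subseteq>X. card Z \<le> d \<and> consistent_set (X, \<Sigma>, E) Z \<and> (\<forall>F\<in>set ys. \<not> Z \<subseteq> F)) \<or>
        (\<exists>ps. length ps = Suc d \<and> set ps \<subseteq> set ys \<times> X \<and>
          consistent_set (X, \<Sigma>, E) (X \<inter> (\<Inter>(F, y)\<in>set ps. insert y F)) \<and>
          (\<forall>F\<in>set ys. \<not> X \<inter> (\<Inter>(F, y)\<in>set ps. insert y F) \<subseteq> F))"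
      proof (rule candidate_exists[OF X TX max])
        show "consistent_set (X, \<Sigma>, E) F" if "F \<in> set ys" for F
          using maxCC_consistent[of F X \<Sigma> E] Fs(3) that by blast
      qed (assumption, rule local)
      then show False
      proof (elim disjE exE conjE)
        fix Z
        assume Z: "Z \<subseteq> X" "card Z \<le> d" "consistent_set (X, \<Sigma>, E) Z" "\<forall>F\<in>set ys. \<not> Z \<subseteq> F"
        then obtain J where "J \<in> set (small_candidates d w)" "elems J = Z"
          using small_candidates_complete[of Z w d] w(2) by auto
        then show False
          using cand[of J] Z by simp
      next
        fix ps
        assume ps: "length ps = Suc d" "set ps \<subseteq> set ys \<times> X"
          "consistent_set (X, \<Sigma>, E) (X \<inter> (\<Inter>(F, y)\<in>set ps. insert y F))"
          "\<forall>F\<in>set ys. \<not> X \<inter> (\<Inter>(F, y)\<in>set ps. insert y F) \<subseteq> F"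
        have "set ps \<subseteq> elems ` elems ?S \<times> elems (left w)"
          using ps(2) unfolding w(2) ys .
        from large_candidates_complete[OF ps(1) this] obtain J
          where J: "X \<inter> (\<Inter>(F, y)\<in>set ps. insert y F) = elems J"
            "J \<in> set (large_candidates (Suc d) w ?S)"
          unfolding w(2) by (rule imageE)
        have "J \<in> set (small_candidates d w @ large_candidates (Suc d) w ?S)"
          unfolding set_append using J(2) by (rule UnI2)
        then show False
          using ps(3,4) cand[of J] unfolding J(1) by (metis Int_lower1 J(1))
      qed
    qed
    then show ?thesis
      using Nil by (simp add: N_def new_solution_def)
  next
    case (Cons J Js)
    then have J: "elems J \<subseteq> X" "consistent_set (X, \<Sigma>, E) (elems J)" "distinct (list_of J)"
      "\<forall>F\<in>set ys. \<not> elems J \<subseteq> F"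
      using sound[of J] by auto
    note e = extend[OF enc X \<Sigma> J(1-3)]
    have "elems (extend w J) \<notin> set ys"
      using e(1) J(4) by blast
    moreover have "N = Branch (extend w J) Leaf"
      by (simp add: N_def new_solution_def Cons)
    moreover have "enc_set (=) (extend w J) (elems (extend w J))"
      using e(3) by (simp add: enc_set_eq)
    ultimately show ?thesis
      using e(2) by (intro disjI2) blast
  qed
qed

section \<open>Caratheodory numbers\<close>

definition caratheodory_number_le :: "nat \<Rightarrow> 'a set \<Rightarrow> 'a set set \<Rightarrow> bool" where
  "caratheodory_number_le c X \<F> \<longleftrightarrow> (\<forall>Y\<subseteq>X. \<forall>x\<in>(\<lambda>F. F \<in> \<F>) hull Y.
    \<exists>Z\<subseteq>Y. card Z \<le> c \<and> x \<in> (\<lambda>F. F \<in> \<F>) hull Z)"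

text \<open>The contrapositive, as a separation property: instead of determining the closure of
  \<open>Y\<close>, each case has to exhibit one closed set that contains \<open>Y\<close> and
  misses \<open>x\<close>.\<close>

lemma caratheodory_number_leI:
  assumes "\<And>Y x. Y \<subseteq> X \<Longrightarrow> (\<And>Z. Z \<subseteq> Y \<Longrightarrow> card Z \<le> c \<Longrightarrow> x \<notin> (\<lambda>F. F \<in> \<F>) hull Z) \<Longrightarrow>
    \<exists>F\<in>\<F>. Y \<subseteq> F \<and> x \<notin> F"
  shows "caratheodory_number_le c X \<F>"
  unfolding caratheodory_number_le_def
proof (intro allI impI ballI, rule ccontr)
  fix Y x
  assume Y: "Y \<subseteq> X" "x \<in> (\<lambda>F. F \<in> \<F>) hull Y"
    and "\<not> (\<exists>Z\<subseteq>Y. card Z \<le> c \<and> x \<in> (\<lambda>F. F \<in> \<F>) hull Z)"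
  then obtain F where "F \<in> \<F>" "Y \<subseteq> F" "x \<notin> F"
    using assms[of Y x] by blast
  then show False
    using Y(2) by (auto simp: hull_def)
qed

text \<open>The union of the closures of the points of \<open>Y\<close> is closed and misses
  \<open>x\<close>. The closure of the empty set starts the union, so that empty \<open>Y\<close> is
  covered too.\<close>

lemma caratheodory_distributive:
  assumes "implicational_base X \<Sigma>" "finite X" "distributive (closure_system X \<Sigma>)"
  shows "caratheodory_number_le 1 X (closure_system X \<Sigma>)"
proof (rule caratheodory_number_leI)
  fix Y x
  assume Y: "Y \<subseteq> X" and x: "\<And>Z. Z \<subseteq> Y \<Longrightarrow> card Z \<le> 1 \<Longrightarrow> x \<notin> cl X \<Sigma> Z"
  have "\<exists>F\<in>closure_system X \<Sigma>. Y' \<subseteq> F \<and> x \<notin> F" if "finite Y'" "Y' \<subseteq> Y" for Y'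
    using that
  proof (induction Y')
    case empty
    then show ?case
      using cl_in_closure_system[OF assms(1), of "{}"] x[of "{}"] by auto
  next
    case (insert y Y')
    then obtain F where F: "F \<in> closure_system X \<Sigma>" "Y' \<subseteq> F" "x \<notin> F"
      by auto
    have y: "cl X \<Sigma> {y} \<in> closure_system X \<Sigma>" "x \<notin> cl X \<Sigma> {y}" "y \<in> cl X \<Sigma> {y}"
      using cl_in_closure_system[OF assms(1), of "{y}"] x[of "{y}"] insert.prems Y
      by (auto intro: hull_inc)
    then have "F \<union> cl X \<Sigma> {y} \<in> closure_system X \<Sigma>"
      using assms(3) F(1) unfolding distributive_def by blast
    then show ?case
      using F y by (intro bexI[of _ "F \<union> cl X \<Sigma> {y}"]) auto
  qed
  then show "\<exists>F\<in>closure_system X \<Sigma>. Y \<subseteq> F \<and> x \<notin> F"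
    using finite_subset[OF Y assms(2)] by blast
qed

text \<open>The convex hull of \<open>Y\<close> is the union \<open>?C\<close> of the order
  intervals with both ends in \<open>Y\<close>, and a point of an interval is generated by its two
  ends.\<close>

lemma caratheodory_poset:
  assumes "poset_convexity X \<F>"
  shows "caratheodory_number_le 2 X \<F>"
proof (rule caratheodory_number_leI)
  obtain r where r: "partial_order_on X r" and F: "\<F> = {Y. Y \<subseteq> X \<and> poset_convex X r Y}"
    using assms unfolding poset_convexity_def by blast
  then have refl: "refl_on X r" and trans: "trans r"
    by (auto simp: partial_order_on_def preorder_on_def)
  fix Y x
  assume Y: "Y \<subseteq> X" and x: "\<And>Z. Z \<subseteq> Y \<Longrightarrow> card Z \<le> 2 \<Longrightarrow> x \<notin> (\<lambda>F. F \<in> \<F>) hull Z"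
  let ?C = "{z \<in> X. \<exists>a\<in>Y. \<exists>b\<in>Y. (a, z) \<in> r \<and> (z, b) \<in> r}"
  have "poset_convex X r ?C"
    unfolding poset_convex_def using trans by (blast dest: transD)
  moreover have "Y \<subseteq> ?C"
    using Y refl by (auto simp: refl_on_def)
  moreover have "x \<notin> ?C"
  proof
    assume "x \<in> ?C"
    then obtain a b where ab: "x \<in> X" "a \<in> Y" "b \<in> Y" "(a, x) \<in> r" "(x, b) \<in> r"
      by blast
    have "x \<in> (\<lambda>F. F \<in> \<F>) hull {a, b}"
      using ab unfolding hull_def F poset_convex_def by auto
    moreover have "card {a, b} \<le> 2"
      by (simp add: card_insert_if)
    ultimately show False
      using x[of "{a, b}"] ab by blast
  qed
  ultimately show "\<exists>F\<in>\<F>. Y \<subseteq> F \<and> x \<notin> F"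
    unfolding F by (intro bexI[of _ ?C]) auto
qed

text \<open>Caratheodory's theorem for convex hulls in dimension k, carried over to \<open>X\<close>
  along the injection \<open>pt\<close>.\<close>

lemma caratheodory_affine:
  assumes "affine_convexity TYPE(real ^ 'k) X \<F>" "\<And>F. F \<in> \<F> \<Longrightarrow> F \<subseteq> X"
  shows "caratheodory_number_le (CARD('k) + 1) X \<F>"
proof (rule caratheodory_number_leI)
  obtain pt :: "'a \<Rightarrow> real ^ 'k" where inj: "inj_on pt X"
    and pt: "(\<lambda>F. pt ` F) ` \<F> = affine_convex_geometry (pt ` X)"
    using assms(1) unfolding affine_convexity_def by blast
  \<comment> \<open>The definition provides some generating set \<open>Q\<close>; the image of
    \<open>F\<close> lies in the hull of \<open>Q\<close>, so it can serve as its own generating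
    set.\<close>
  have closed: "pt ` F = convex hull (pt ` F) \<inter> pt ` X" if F: "F \<in> \<F>" for F
  proof -
    have "pt ` F \<in> affine_convex_geometry (pt ` X)"
      unfolding pt[symmetric] using F by (rule imageI)
    then obtain Q where Q: "Q \<subseteq> pt ` X" "pt ` F = convex hull Q \<inter> pt ` X"
      by (auto simp: affine_convex_geometry_def)
    have "convex hull (pt ` F) \<subseteq> convex hull Q"
      by (intro hull_minimal convex_convex_hull) (simp add: Q(2))
    then have "convex hull (pt ` F) \<inter> pt ` X \<subseteq> pt ` F"
      unfolding Q(2) by (rule Int_mono) simp
    moreover have "pt ` F \<subseteq> convex hull (pt ` F) \<inter> pt ` X"
      using assms(2)[OF F] by (intro Int_greatest hull_subset image_mono)
    ultimately show ?thesis
      by (rule equalityI[rotated])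
  qed
  fix Y x
  assume Y: "Y \<subseteq> X" and x: "\<And>Z. Z \<subseteq> Y \<Longrightarrow> card Z \<le> CARD('k) + 1 \<Longrightarrow> x \<notin> (\<lambda>F. F \<in> \<F>) hull Z"
  have "convex hull (pt ` Y) \<inter> pt ` X \<in> (\<lambda>F. pt ` F) ` \<F>"
    unfolding pt affine_convex_geometry_def using image_mono[OF Y] by (intro CollectI exI[of _ "pt ` Y"]) simp
  then obtain F where F: "F \<in> \<F>" "pt ` F = convex hull (pt ` Y) \<inter> pt ` X"
    by auto
  have "pt ` Y \<subseteq> pt ` F"
    unfolding F(2) using Y by (intro Int_greatest hull_subset image_mono)
  then have "Y \<subseteq> F"
    using inj_on_image_subset_iff[OF inj Y assms(2)[OF F(1)]] by simp
  moreover have "x \<notin> F"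
  proof
    assume "x \<in> F"
    then have xX: "x \<in> X"
      using assms(2)[OF F(1)] by blast
    from \<open>x \<in> F\<close> have "pt x \<in> convex hull (pt ` Y)"
      using F(2) imageI[of x F pt] by simp
    then obtain S where S: "finite S" "S \<subseteq> pt ` Y" "card S \<le> CARD('k) + 1" "pt x \<in> convex hull S"
      unfolding caratheodory[of "pt ` Y"] mem_Collect_eq by (elim exE conjE) (rule that, simp_all)
    from S(2) obtain Z where Z: "Z \<subseteq> Y" "S = pt ` Z"
      by (rule subset_imageE)
    have "card Z = card S"
      unfolding Z(2) using inj_on_subset[OF inj subset_trans[OF Z(1) Y]] by (simp add: card_image)
    moreover have "x \<in> G" if G: "G \<in> \<F>" "Z \<subseteq> G" for G
    proof -
      have "pt x \<in> convex hull (pt ` G)"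
        using hull_mono[OF image_mono[OF G(2)]] S(4) unfolding Z(2) by (rule subsetD)
      then have "pt x \<in> pt ` G"
        using xX by (subst closed[OF G(1)]) simp
      then show ?thesis
        using inj_on_image_mem_iff[OF inj xX assms(2)[OF G(1)]] by simp
    qed
    then have "x \<in> (\<lambda>F. F \<in> \<F>) hull Z"
      by (simp add: hull_def)
    ultimately show False
      using x[OF Z(1)] S(3) by simp
  qed
  ultimately show "\<exists>F\<in>\<F>. Y \<subseteq> F \<and> x \<notin> F"
    using F(1) by blast
qed

section \<open>Chordless paths and gates in chordal graphs\<close>

definition adjacency :: "'a set set \<Rightarrow> 'a set \<Rightarrow> 'a rel" where
  "adjacency E W = {(p, q). p \<in> W \<and> q \<in> W \<and> {p, q} \<in> E}"

lemma sym_reach: "sym ((adjacency E W)\<^sup>*)"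
  by (intro sym_rtrancl) (auto simp: sym_def adjacency_def insert_commute)

lemma reach_mono: "(a, b) \<in> (adjacency E W)\<^sup>* \<Longrightarrow> W \<subseteq> W' \<Longrightarrow> (a, b) \<in> (adjacency E W')\<^sup>*"
  by (rule rtrancl_mono[THEN subsetD, rotated]) (auto simp: adjacency_def)

text \<open>Vertices may repeat, so that cutting out a piece and joining the ends leaves a walk;
  distinctness is recovered from minimal length.\<close>

definition walk :: "'a set set \<Rightarrow> 'a set \<Rightarrow> 'a \<Rightarrow> 'a list \<Rightarrow> 'a \<Rightarrow> bool" where
  "walk E W a ps b \<longleftrightarrow> ps \<noteq> [] \<and> hd ps = a \<and> last ps = b \<and> set ps \<subseteq> W \<and>
    (\<forall>i. Suc i < length ps \<longrightarrow> {ps ! i, ps ! Suc i} \<in> E)"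

lemma walk_Cons: "walk E W p ps b \<Longrightarrow> a \<in> W \<Longrightarrow> {a, p} \<in> E \<Longrightarrow> walk E W a (a # ps) b"
  by (auto simp: walk_def nth_Cons hd_conv_nth split: nat.splits)

text \<open>The reflexive closure relates \<open>b\<close> to itself even outside \<open>W\<close>;
  the assumption \<open>b \<in> W\<close> excludes this.\<close>

lemma walk_exists:
  assumes "(a, b) \<in> (adjacency E W)\<^sup>*" "b \<in> W"
  shows "\<exists>ps. walk E W a ps b"
  using assms(1)
proof (induction rule: converse_rtrancl_induct)
  case base
  show ?case
    using assms(2) by (intro exI[of _ "[b]"]) (simp add: walk_def)
next
  case (step a p)
  then show ?case
    using walk_Cons[of E W p _ b a] by (auto simp: adjacency_def)
qed

text \<open>Positions \<open>i\<close> to \<open>k - 1\<close> are removed. This covers a repeated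
  vertex at \<open>i\<close> and \<open>k\<close> as well as a chord from \<open>i - 1\<close> to
  \<open>k\<close>, so minimal length excludes both in the same way.\<close>

lemma walk_shortcut:
  assumes "walk E W a ps b" "i < k" "k < length ps" "i = 0 \<longrightarrow> ps ! k = a"
    "0 < i \<longrightarrow> {ps ! (i - 1), ps ! k} \<in> E"
  shows "walk E W a (take i ps @ drop k ps) b"
  unfolding walk_def
proof (intro conjI allI impI)
  note w = assms(1)[unfolded walk_def]
  show "take i ps @ drop k ps \<noteq> []"
    using assms(3) by simp
  show "hd (take i ps @ drop k ps) = a"
    using w assms(2-4) by (cases "i = 0") (auto simp: hd_drop_conv_nth hd_append)
  show "last (take i ps @ drop k ps) = b"
    using w assms(3) by simp
  show "set (take i ps @ drop k ps) \<subseteq> W"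
    using w set_take_subset[of i ps] set_drop_subset[of k ps] by auto
  fix j
  assume j: "Suc j < length (take i ps @ drop k ps)"
  have len: "length (take i ps) = i"
    using assms(2,3) by simp
  consider "Suc j < i" | "Suc j = i" | "i \<le> j"
    by linarith
  then show "{(take i ps @ drop k ps) ! j, (take i ps @ drop k ps) ! Suc j} \<in> E"
  proof cases
    case 1
    then show ?thesis
      using w len assms(2,3) by (simp add: nth_append)
  next
    case 2
    then show ?thesis
      using assms(3,5) len by (auto simp: nth_append)
  next
    case 3
    then have k: "Suc (k + j - i) < length ps" "Suc (k + j) - i = Suc (k + j - i)"
      "k + (j - i) = k + j - i" "k + (Suc j - i) = Suc (k + j - i)"
      using j assms(2,3) by auto
    then have "{ps ! (k + j - i), ps ! Suc (k + j - i)} \<in> E"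
      using w by blast
    then show ?thesis
      using 3 len assms(3) k by (simp add: nth_append)
  qed
qed

text \<open>A shortest walk is a chordless path.\<close>

lemma chordless_path_exists:
  assumes "(a, b) \<in> (adjacency E W)\<^sup>*" "b \<in> W"
  obtains ps where "path_between W E a ps b" "chordless E ps"
proof -
  define ps where "ps = arg_min length (\<lambda>ps. walk E W a ps b)"
  have ex: "\<exists>ps. walk E W a ps b"
    using walk_exists[OF assms] .
  have w: "walk E W a ps b"
    unfolding ps_def using arg_min_natI[of "\<lambda>ps. walk E W a ps b"] ex by blast
  have min: "length ps \<le> length qs" if "walk E W a qs b" for qs
    unfolding ps_def using that by (rule arg_min_nat_le)
  have no_shortcut: False if "walk E W a (take i ps @ drop k ps) b" "i < k" "k < length ps" for i k
    using min[OF that(1)] that(2,3) by simp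
  have edge: "{ps ! i, ps ! Suc i} \<in> E" if "Suc i < length ps" for i
    using w that by (simp add: walk_def)
  have a: "ps ! 0 = a"
    using w by (auto simp: walk_def hd_conv_nth)
  have "ps ! i \<noteq> ps ! k" if "i < k" "k < length ps" for i k
  proof
    assume eq: "ps ! i = ps ! k"
    have "walk E W a (take i ps @ drop k ps) b"
      using eq a edge[of "i - 1"] that by (intro walk_shortcut[OF w that]) auto
    then show False
      using no_shortcut that by blast
  qed
  then have "distinct ps"
    by (metis distinct_conv_nth linorder_neqE_nat)
  moreover have "chordless E ps"
    unfolding chordless_def
  proof (intro allI impI notI)
    fix i j
    assume ij: "Suc i < j \<and> j < length ps" and e: "{ps ! i, ps ! j} \<in> E"
    have "walk E W a (take (Suc i) ps @ drop j ps) b"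
      using ij e by (intro walk_shortcut[OF w]) auto
    then show False
      using no_shortcut ij by blast
  qed
  ultimately show thesis
    using w that by (auto simp: walk_def path_between_def)
qed

lemma path_between_reach:
  assumes "path_between X E a ps b" "i < length ps" "\<And>j. j \<le> i \<Longrightarrow> ps ! j \<in> W"
  shows "(a, ps ! i) \<in> (adjacency E W)\<^sup>*"
  using assms(2,3)
proof (induction i)
  case 0
  then show ?case
    using assms(1) by (auto simp: path_between_def hd_conv_nth)
next
  case (Suc i)
  have "(ps ! i, ps ! Suc i) \<in> adjacency E W"
    using Suc.prems assms(1) by (auto simp: adjacency_def path_between_def)
  then show ?case
    using Suc by (meson Suc_lessD le_SucI rtrancl.rtrancl_into_rtrancl)
qed

text \<open>A chordless path from \<open>u\<close> to \<open>v\<close> in \<open>W\<close> has at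
  least three vertices, as \<open>u\<close> and \<open>v\<close> are distinct and nonadjacent. Since
  \<open>x\<close> is adjacent to its two ends only, it closes the path to an induced cycle of
  length at least 4.\<close>

lemma chordal_cycle:
  assumes G: "chordal X E" and W: "W \<subseteq> X" "x \<in> X" "x \<notin> W" "u \<in> W" "v \<in> W"
    and N: "\<And>z. z \<in> W \<Longrightarrow> {x, z} \<in> E \<longleftrightarrow> z = u \<or> z = v"
    and uv: "u \<noteq> v" "{u, v} \<notin> E"
  shows "(u, v) \<notin> (adjacency E W)\<^sup>*"
proof
  assume "(u, v) \<in> (adjacency E W)\<^sup>*"
  from chordless_path_exists[OF this W(5)] obtain ps
    where ps: "path_between W E u ps v" and chordless: "chordless E ps"
    by blast
  note p = ps[unfolded path_between_def]
  have ends: "ps ! 0 = u" "ps ! (length ps - 1) = v"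
    using p by (auto simp: hd_conv_nth last_conv_nth)
  have len: "length ps \<ge> 3"
  proof (rule ccontr)
    assume "\<not> length ps \<ge> 3"
    then have "length ps = 1 \<or> length ps = 2"
      using p by (cases "length ps") auto
    then show False
      using p ends uv by auto
  qed
  have nth_eq: "ps ! j = u \<longleftrightarrow> j = 0" "ps ! j = v \<longleftrightarrow> j = length ps - 1" if "j < length ps" for j
    using p ends that nth_eq_iff_index_eq[of ps j 0] nth_eq_iff_index_eq[of ps j "length ps - 1"]
    by auto
  have "induced_cycle X E (x # ps)"
    unfolding induced_cycle_def
  proof (intro conjI allI impI)
    show "3 \<le> length (x # ps)" "distinct (x # ps)" "set (x # ps) \<subseteq> X"
      using len p W by auto
    fix i j
    assume ij: "i < j \<and> j < length (x # ps)"
    then obtain j' where j: "j = Suc j'" "j' < length ps"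
      by (cases j) auto
    show "{(x # ps) ! i, (x # ps) ! j} \<in> E \<longleftrightarrow> j = Suc i \<or> (i = 0 \<and> Suc j = length (x # ps))"
    proof (cases i)
      case 0
      have "{x, ps ! j'} \<in> E \<longleftrightarrow> ps ! j' = u \<or> ps ! j' = v"
        using p j by (intro N) auto
      then show ?thesis
        using 0 j nth_eq[OF j(2)] by auto
    next
      case (Suc i')
      then have "i' < j'" "j' < length ps"
        using ij j by auto
      then have "{ps ! i', ps ! j'} \<in> E \<longleftrightarrow> j' = Suc i'"
        using chordless p unfolding chordless_def by (metis Suc_lessI)
      then show ?thesis
        using Suc j by simp
    qed
  qed
  then show False
    using G len unfolding chordal_def by (metis Suc_le_mono length_Cons numeral_eq_Suc pred_numeral_simps(2) semiring_norm(26,27,28))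
qed

text \<open>
  The set of neighbours of \<open>x\<close> at which a path starting in \<open>a\<close> may meet the neighbourhood of \<open>x\<close>
  for the first time.
\<close>

definition gates :: "'a set \<Rightarrow> 'a set set \<Rightarrow> 'a \<Rightarrow> 'a \<Rightarrow> 'a set" where
  "gates X E x a = {u \<in> X. {x, u} \<in> E \<and>
    (a, u) \<in> (adjacency E (insert u {z \<in> X. z \<noteq> x \<and> {x, z} \<notin> E}))\<^sup>*}"

text \<open>
  If a set of vertices has nonadjacent gates, then \<open>x\<close> lies on a chordless path between two of its
  members, because a chordless path avoiding \<open>x\<close> would close an induced cycle through \<open>x\<close>.
\<close>

lemma chordless_path_through:
  assumes G: "chordal X E" and x: "x \<in> X" and ab: "a \<in> X" "b \<in> X" "a \<noteq> x" "b \<noteq> x"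
    and u: "u \<in> gates X E x a" and v: "v \<in> gates X E x b" and uv: "u \<noteq> v" "{u, v} \<notin> E"
  shows "\<exists>ps. path_between X E a ps b \<and> chordless E ps \<and> x \<in> set ps"
proof -
  let ?D = "{z \<in> X. z \<noteq> x \<and> {x, z} \<notin> E}"
  \<comment> \<open>A region in which \<open>u\<close> and \<open>v\<close> are the only neighbours
    of \<open>x\<close>, as \<open>chordal_cycle\<close> demands.\<close>
  let ?W = "insert u (insert v ?D)"
  have loop: "{z} \<notin> E" for z
    using G unfolding chordal_def simple_graph_def by (metis doubleton_eq_iff insert_absorb2)
  have u': "u \<in> X" "{x, u} \<in> E" "u \<noteq> x" and v': "v \<in> X" "{x, v} \<in> E" "v \<noteq> x"
    using u v loop[of x] by (auto simp: gates_def)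
  have au: "(a, u) \<in> (adjacency E ?W)\<^sup>*"
    using u by (auto simp: gates_def intro: reach_mono)
  have bv: "(b, v) \<in> (adjacency E ?W)\<^sup>*"
    using v by (auto simp: gates_def intro: reach_mono)
  have vb: "(v, b) \<in> (adjacency E ?W)\<^sup>*"
    using bv sym_reach[of E ?W] by (auto dest: symD)
  have W: "?W \<subseteq> insert x ?W"
    by blast
  have "(u, x) \<in> adjacency E (insert x ?W)" "(x, v) \<in> adjacency E (insert x ?W)"
    using u' v' by (auto simp: adjacency_def insert_commute)
  then have ab': "(a, b) \<in> (adjacency E (insert x ?W))\<^sup>*"
    using reach_mono[OF au W] reach_mono[OF vb W] by (meson r_into_rtrancl rtrancl_trans)
  have "b \<in> ?W"
    using bv by (cases rule: converse_rtranclE) (auto simp: adjacency_def)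
  then obtain ps where ps: "path_between (insert x ?W) E a ps b" "chordless E ps"
    using chordless_path_exists[OF ab'] by auto
  have "x \<in> set ps"
  proof (rule ccontr)
    assume "x \<notin> set ps"
    then have sub: "set ps \<subseteq> ?W"
      using ps(1) by (auto simp: path_between_def)
    have "(a, ps ! (length ps - 1)) \<in> (adjacency E ?W)\<^sup>*"
    proof (rule path_between_reach[OF ps(1)])
      show "length ps - 1 < length ps"
        using ps(1) by (simp add: path_between_def)
      then show "ps ! j \<in> ?W" if "j \<le> length ps - 1" for j
        using sub that by (meson le_less_trans nth_mem subsetD)
    qed
    then have "(a, b) \<in> (adjacency E ?W)\<^sup>*"
      using ps(1) by (auto simp: path_between_def last_conv_nth)
    then have "(u, v) \<in> (adjacency E ?W)\<^sup>*"
      using au bv sym_reach[of E ?W] by (meson rtrancl_trans symD)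
    moreover have "{x, z} \<in> E \<longleftrightarrow> z = u \<or> z = v" if "z \<in> ?W" for z
      using that u' v' by auto
    then have "(u, v) \<notin> (adjacency E ?W)\<^sup>*"
      using u' v' x uv by (intro chordal_cycle[OF G _ x]) auto
    ultimately show False
      by blast
  qed
  moreover have "path_between X E a ps b"
    using ps(1) u' v' x unfolding path_between_def by auto
  ultimately show ?thesis
    using ps(2) by blast
qed

lemma first_gate:
  assumes "path_between X E a ps b" "p < length ps" "x \<notin> set (take p ps)"
    and "{x, ps ! p} \<in> E" "\<And>i. i < p \<Longrightarrow> {x, ps ! i} \<notin> E"
  shows "ps ! p \<in> gates X E x a"
proof -
  let ?W = "insert (ps ! p) {z \<in> X. z \<noteq> x \<and> {x, z} \<notin> E}"
  have in_X: "ps ! i \<in> X" if "i < length ps" for i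
    using assms(1) that by (auto simp: path_between_def)
  have W: "ps ! i \<in> ?W" if "i \<le> p" for i
  proof (cases "i = p")
    case False
    then have "i < p"
      using that by simp
    then have "ps ! i \<in> set (take p ps)"
      using assms(2) by (auto simp: in_set_conv_nth intro!: exI[of _ i])
    then show ?thesis
      using in_X[of i] assms(2,3,5) \<open>i < p\<close> by auto
  qed simp
  have "(a, ps ! p) \<in> (adjacency E ?W)\<^sup>*"
    using path_between_reach[OF assms(1,2) W] .
  then show ?thesis
    using in_X[OF assms(2)] assms(4) by (simp add: gates_def)
qed

lemma path_between_rev: "path_between X E a ps b \<Longrightarrow> path_between X E b (rev ps) a"
  unfolding path_between_def
proof (intro conjI allI impI)
  fix i
  assume ps: "ps \<noteq> [] \<and> hd ps = a \<and> last ps = b \<and> distinct ps \<and> set ps \<subseteq> X \<and>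
    (\<forall>i. Suc i < length ps \<longrightarrow> {ps ! i, ps ! Suc i} \<in> E)" and i: "Suc i < length (rev ps)"
  then have "{ps ! (length ps - Suc (Suc i)), ps ! Suc (length ps - Suc (Suc i))} \<in> E"
    by auto
  then show "{rev ps ! i, rev ps ! Suc i} \<in> E"
    using i by (simp add: rev_nth insert_commute Suc_diff_Suc)
qed (auto simp: hd_rev last_rev)

text \<open>The first neighbour of \<open>x\<close> on the path is a gate. Were \<open>x\<close>
  itself to occur earlier, its predecessor, which exists because \<open>a\<close> differs from
  \<open>x\<close>, would be a neighbour earlier still.\<close>

lemma gate_on_path:
  assumes ps: "path_between X E a ps b" and a: "a \<noteq> x" and i: "i < length ps" "{x, ps ! i} \<in> E"
  shows "\<exists>p\<le>i. ps ! p \<in> gates X E x a \<and> (\<forall>j<p. {x, ps ! j} \<notin> E)"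
proof -
  define p where "p = (LEAST p. {x, ps ! p} \<in> E)"
  have p: "{x, ps ! p} \<in> E" "p \<le> i" "\<And>j. j < p \<Longrightarrow> {x, ps ! j} \<notin> E"
    unfolding p_def using i(2) LeastI[of "\<lambda>p. {x, ps ! p} \<in> E"] Least_le[of "\<lambda>p. {x, ps ! p} \<in> E"]
      not_less_Least[of _ "\<lambda>p. {x, ps ! p} \<in> E"] by blast+
  have "x \<notin> set (take p ps)"
  proof
    assume "x \<in> set (take p ps)"
    then obtain j where j: "j < p" "j < length ps" "ps ! j = x"
      by (auto simp: in_set_conv_nth)
    have "j \<noteq> 0"
      using j ps a by (cases "j = 0") (auto simp: path_between_def hd_conv_nth)
    then have "{ps ! (j - 1), x} \<in> E"
      using ps j unfolding path_between_def by (metis Suc_pred' bot_nat_0.not_eq_extremum)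
    moreover have "j - 1 < p"
      using j(1) by simp
    ultimately show False
      using p(3)[of "j - 1"] by (simp add: insert_commute)
  qed
  then show ?thesis
    using p i(1) by (intro exI[of _ p] conjI first_gate[OF ps]) auto
qed

text \<open>A neighbour \<open>y\<close> of \<open>x\<close> lies in the permitted region only if it
  is the gate itself, so no step can be taken from it towards another gate.\<close>

lemma gates_neighbour:
  assumes "{x, y} \<in> E"
  shows "gates X E x y \<subseteq> {y}"
proof
  fix u
  assume "u \<in> gates X E x y"
  then have "(y, u) \<in> (adjacency E (insert u {z \<in> X. z \<noteq> x \<and> {x, z} \<notin> E}))\<^sup>*"
    by (simp add: gates_def)
  then show "u \<in> {y}"
    using assms by (cases rule: converse_rtranclE) (auto simp: adjacency_def)
qed

lemma gates_reach:
  assumes "(a, y) \<in> (adjacency E {z \<in> X. z \<noteq> x \<and> {x, z} \<notin> E})\<^sup>*"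
  shows "gates X E x y \<subseteq> gates X E x a"
proof
  fix u
  assume u: "u \<in> gates X E x y"
  have "(a, y) \<in> (adjacency E (insert u {z \<in> X. z \<noteq> x \<and> {x, z} \<notin> E}))\<^sup>*"
    using reach_mono[OF assms] by blast
  then show "u \<in> gates X E x a"
    using u by (auto simp: gates_def intro: rtrancl_trans)
qed

text \<open>An initial segment without neighbours of \<open>x\<close> runs inside the region open to
  every gate, so gates can be carried back to the start of the path.\<close>

lemma gates_prefix:
  assumes "path_between X E a ps b" "i < length ps" "x \<notin> set ps" "\<And>j. j \<le> i \<Longrightarrow> {x, ps ! j} \<notin> E"
  shows "gates X E x (ps ! i) \<subseteq> gates X E x a"
proof (rule gates_reach, rule path_between_reach[OF assms(1,2)])
  fix j
  assume j: "j \<le> i"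
  then have "ps ! j \<in> set ps"
    using assms(2) by simp
  then show "ps ! j \<in> {z \<in> X. z \<noteq> x \<and> {x, z} \<notin> E}"
    using assms(1,3) assms(4)[OF j] by (auto simp: path_between_def)
qed

text \<open>
  On a chordless path between two vertices with gates in the clique \<open>K\<close>, the first and the last
  neighbour of \<open>x\<close> lie in \<open>K\<close>. So they are equal or adjacent, hence consecutive on the path, and every
  other vertex of the path is joined to an end of it outside the neighbourhood of \<open>x\<close>.
\<close>

lemma monophonically_convex_gates:
  assumes K: "\<And>u v. u \<in> K \<Longrightarrow> v \<in> K \<Longrightarrow> u \<noteq> v \<Longrightarrow> {u, v} \<in> E"
  shows "monophonically_convex X E {z \<in> X. z \<noteq> x \<and> gates X E x z \<subseteq> K}"
  unfolding monophonically_convex_def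
proof (intro ballI allI impI subsetI)
  fix a b ps y
  assume a: "a \<in> {z \<in> X. z \<noteq> x \<and> gates X E x z \<subseteq> K}" and b: "b \<in> {z \<in> X. z \<noteq> x \<and> gates X E x z \<subseteq> K}"
    and "path_between X E a ps b \<and> chordless E ps" and y: "y \<in> set ps"
  then have ps: "path_between X E a ps b" and chordless: "chordless E ps"
    by auto
  note rev = path_between_rev[OF ps]
  have a': "a \<noteq> x" "gates X E x a \<subseteq> K" and b': "b \<noteq> x" "gates X E x b \<subseteq> K"
    using a b by simp_all
  have rev_nth': "rev ps ! (length ps - Suc j) = ps ! j" if "j < length ps" for j
    using that by (simp add: rev_nth)
  \<comment> \<open>Position \<open>p\<close> comes from the gate met first from \<open>a\<close>,
    position \<open>q\<close> from the gate met first from \<open>b\<close> along the reversed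
    path.\<close>
  have bracket: "\<exists>p q. p \<le> i \<and> i \<le> q \<and> q \<le> Suc p \<and> ps ! p \<in> K \<and> ps ! q \<in> K \<and>
      (\<forall>j<length ps. {x, ps ! j} \<in> E \<longrightarrow> j \<le> q)"
    if i: "i < length ps" "{x, ps ! i} \<in> E" for i
  proof -
    obtain p where "p \<le> i" "ps ! p \<in> gates X E x a"
      using gate_on_path[OF ps a'(1) i] by (elim exE conjE)
    then have p: "p \<le> i" "ps ! p \<in> K"
      using a'(2) by (simp_all add: subsetD)
    have ri: "length ps - Suc i < length (rev ps)" "{x, rev ps ! (length ps - Suc i)} \<in> E"
      using i rev_nth' by auto
    obtain q' where q'': "q' \<le> length ps - Suc i" "rev ps ! q' \<in> gates X E x b"
      "\<forall>j<q'. {x, rev ps ! j} \<notin> E"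
      using gate_on_path[OF rev b'(1) ri] by (elim exE conjE)
    then have q': "q' \<le> length ps - Suc i" "rev ps ! q' \<in> K" "\<And>j. j < q' \<Longrightarrow> {x, rev ps ! j} \<notin> E"
      using b'(2) by (simp_all add: subsetD)
    define q where "q = length ps - Suc q'"
    have q: "i \<le> q" "q < length ps" "ps ! q \<in> K"
      using q'(1,2) i(1) by (auto simp: q_def rev_nth)
    have last: "j \<le> q" if "j < length ps" "{x, ps ! j} \<in> E" for j
    proof (rule ccontr)
      assume "\<not> j \<le> q"
      then have "length ps - Suc j < q'"
        using that(1) q'(1) i(1) by (simp add: q_def)
      then show False
        using q'(3)[of "length ps - Suc j"] that rev_nth' by simp
    qed
    have "q \<le> Suc p"
    proof (rule ccontr)
      assume "\<not> q \<le> Suc p"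
      moreover from this have "ps ! p \<noteq> ps ! q"
        using ps q(2) by (auto simp: path_between_def nth_eq_iff_index_eq)
      then have "{ps ! p, ps ! q} \<in> E"
        by (rule K[OF p(2) q(3)])
      ultimately show False
        using chordless q(2) by (auto simp: chordless_def)
    qed
    then show ?thesis
      using p q last by (intro exI[of _ p] exI[of _ q]) simp
  qed
  have close: "j \<le> Suc i" if ij: "i < length ps" "j < length ps" "{x, ps ! i} \<in> E" "{x, ps ! j} \<in> E" for i j
  proof -
    obtain p q where "p \<le> i" "q \<le> Suc p" "\<forall>j<length ps. {x, ps ! j} \<in> E \<longrightarrow> j \<le> q"
      using bracket[OF ij(1,3)] by (elim exE conjE)
    then have "j \<le> q" "q \<le> Suc i"
      using ij(2,4) by simp_all
    then show ?thesis
      by simp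
  qed
  have neighbour: "ps ! i \<in> K" if i: "i < length ps" "{x, ps ! i} \<in> E" for i
  proof -
    obtain p q where "p \<le> i" "i \<le> q" "q \<le> Suc p" "ps ! p \<in> K" "ps ! q \<in> K"
      using bracket[OF i] by (elim exE conjE)
    moreover from this have "i = p \<or> i = q"
      by linarith
    ultimately show ?thesis
      by blast
  qed
  \<comment> \<open>As an inner vertex of the path, \<open>x\<close> would have neighbours at
    positions \<open>i - 1\<close> and \<open>i + 1\<close>, two apart, against
    \<open>close\<close>.\<close>
  have "x \<notin> set ps"
  proof
    assume "x \<in> set ps"
    then obtain i where i: "i < length ps" "ps ! i = x"
      by (auto simp: in_set_conv_nth)
    have "ps ! 0 = a" "ps ! (length ps - 1) = b"
      using ps by (auto simp: path_between_def hd_conv_nth last_conv_nth)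
    then have "i \<noteq> 0" "i \<noteq> length ps - 1"
      using i(2) a'(1) b'(1) by metis+
    then have "i - 1 < length ps" "Suc i < length ps" "i = Suc (i - 1)"
      using i(1) by auto
    then have "{ps ! (i - 1), x} \<in> E" "{x, ps ! Suc i} \<in> E"
      using ps i unfolding path_between_def by metis+
    then show False
      using close[of "i - 1" "Suc i"] \<open>i - 1 < length ps\<close> \<open>Suc i < length ps\<close> \<open>i \<noteq> 0\<close>
      by (simp add: insert_commute)
  qed
  obtain i where i: "i < length ps" "y = ps ! i"
    using y by (auto simp: in_set_conv_nth)
  have "gates X E x y \<subseteq> K"
  proof (cases "{x, y} \<in> E")
    case True
    then show ?thesis
      using gates_neighbour[OF True, of X] neighbour[of i] i by auto
  next
    case False
    show ?thesis
    proof (cases "\<exists>j\<le>i. {x, ps ! j} \<in> E")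
      case True
      then obtain j where j: "j < i" "{x, ps ! j} \<in> E"
        using False i(2) by (metis le_neq_implies_less)
      \<comment> \<open>With a neighbour of \<open>x\<close> at \<open>j < i\<close>, by
        \<open>close\<close> all of them lie at positions up to \<open>Suc j \<le> i\<close>, and
        \<open>i\<close> itself is not one. So the segment from \<open>y\<close> to \<open>b\<close>
        is free of neighbours and the gates of \<open>y\<close> are gates of
        \<open>b\<close>.\<close>
      have "{x, rev ps ! k} \<notin> E" if k: "k \<le> length ps - Suc i" for k
      proof
        assume N: "{x, rev ps ! k} \<in> E"
        have k': "rev ps ! k = ps ! (length ps - Suc k)" "i \<le> length ps - Suc k"
          using k i(1) by (auto simp: rev_nth)
        then have "length ps - Suc k \<le> Suc j"
          using close[of j "length ps - Suc k"] N j i(1) by simp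
        then show False
          using k' j N False i(2) by (metis Suc_leI le_antisym le_trans)
      qed
      then have "gates X E x (rev ps ! (length ps - Suc i)) \<subseteq> gates X E x b"
        using gates_prefix[OF rev, of "length ps - Suc i" x] i(1) \<open>x \<notin> set ps\<close> by simp
      then show ?thesis
        using rev_nth'[OF i(1)] i(2) b by auto
    next
      case False
      then show ?thesis
        using gates_prefix[OF ps i(1) \<open>x \<notin> set ps\<close>] i(2) a by blast
    qed
  qed
  then show "y \<in> {z \<in> X. z \<noteq> x \<and> gates X E x z \<subseteq> K}"
    using y \<open>x \<notin> set ps\<close> ps by (auto simp: path_between_def)
qed

text \<open>The gates of \<open>Y\<close> form a clique \<open>?K\<close>, since two nonadjacent
  ones would put \<open>x\<close> into the hull of two points of \<open>Y\<close>. The separating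
  convex set consists of all vertices other than \<open>x\<close> whose gates lie in
  \<open>?K\<close>.\<close>

lemma caratheodory_chordal:
  assumes "chordal_monophonic_convexity X \<F>"
  shows "caratheodory_number_le 2 X \<F>"
proof (rule caratheodory_number_leI)
  obtain E where G: "chordal X E" and F: "\<F> = {Y. Y \<subseteq> X \<and> monophonically_convex X E Y}"
    using assms unfolding chordal_monophonic_convexity_def by blast
  fix Y x
  assume Y: "Y \<subseteq> X" and x: "\<And>Z. Z \<subseteq> Y \<Longrightarrow> card Z \<le> 2 \<Longrightarrow> x \<notin> (\<lambda>F. F \<in> \<F>) hull Z"
  have XF: "X \<in> \<F>"
    unfolding F by (auto simp: monophonically_convex_def path_between_def)
  show "\<exists>F\<in>\<F>. Y \<subseteq> F \<and> x \<notin> F"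
  proof (cases "x \<in> X")
    case False
    then show ?thesis
      using XF Y by blast
  next
    case True
    let ?K = "\<Union>a\<in>Y. gates X E x a"
    let ?C = "{z \<in> X. z \<noteq> x \<and> gates X E x z \<subseteq> ?K}"
    have "x \<notin> Y"
      using x[of "{x}"] by (auto intro: hull_inc)
    have "{u, v} \<in> E" if uv: "u \<in> ?K" "v \<in> ?K" "u \<noteq> v" for u v
    proof (rule ccontr)
      assume nE: "{u, v} \<notin> E"
      obtain a b where ab: "a \<in> Y" "b \<in> Y" "u \<in> gates X E x a" "v \<in> gates X E x b"
        using uv by blast
      obtain ps where ps: "path_between X E a ps b" "chordless E ps" "x \<in> set ps"
        using chordless_path_through[OF G True _ _ _ _ ab(3,4) uv(3) nE] ab(1,2) Y \<open>x \<notin> Y\<close> by blast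
      have "x \<in> S" if "S \<in> \<F>" "{a, b} \<subseteq> S" for S
        using that ps unfolding F monophonically_convex_def by blast
      then have "x \<in> (\<lambda>F. F \<in> \<F>) hull {a, b}"
        by (simp add: hull_def)
      moreover have "card {a, b} \<le> 2"
        by (simp add: card_insert_if)
      ultimately show False
        using x[of "{a, b}"] ab(1,2) by blast
    qed
    then have "monophonically_convex X E ?C"
      by (rule monophonically_convex_gates)
    then have "?C \<in> \<F>"
      unfolding F by blast
    moreover have "Y \<subseteq> ?C"
      using Y \<open>x \<notin> Y\<close> by blast
    ultimately show ?thesis
      by blast
  qed
qed

section \<open>From Caratheodory numbers to enumeration\<close>

lemma consistent_set_local:
  assumes c: "caratheodory_number_le c X (closure_system X \<Sigma>)" and E: "simple_graph X E"
    and Y: "Y \<subseteq> X" and Z: "\<And>Z. Z \<subseteq> Y \<Longrightarrow> card Z \<le> 2 * c \<Longrightarrow> consistent_set (X, \<Sigma>, E) Z"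
  shows "consistent_set (X, \<Sigma>, E) Y"
  unfolding consistent_set.simps independent_set_def
proof (intro ballI notI)
  fix e
  assume e: "e \<in> E" "e \<subseteq> cl X \<Sigma> Y"
  then obtain u v where uv: "e = {u, v}"
    using E unfolding simple_graph_def by blast
  have *: "\<exists>Z\<subseteq>Y. card Z \<le> c \<and> z \<in> cl X \<Sigma> Z" if "z \<in> cl X \<Sigma> Y" for z
    using c[unfolded caratheodory_number_le_def, rule_format, OF Y that] .
  have "u \<in> cl X \<Sigma> Y" "v \<in> cl X \<Sigma> Y"
    using e(2) uv by simp_all
  from *[OF this(1)] *[OF this(2)] obtain A B
    where A: "A \<subseteq> Y" "card A \<le> c" "u \<in> cl X \<Sigma> A"
      and B: "B \<subseteq> Y" "card B \<le> c" "v \<in> cl X \<Sigma> B"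
    by (elim exE conjE)
  have "card (A \<union> B) \<le> 2 * c"
    using card_Un_le[of A B] A(2) B(2) by simp
  then have "consistent_set (X, \<Sigma>, E) (A \<union> B)"
    using A(1) B(1) by (intro Z) simp_all
  moreover have "u \<in> cl X \<Sigma> (A \<union> B)"
    by (rule subsetD[OF hull_mono A(3)]) simp
  moreover have "v \<in> cl X \<Sigma> (A \<union> B)"
    by (rule subsetD[OF hull_mono B(3)]) simp
  ultimately show False
    using e(1) uv by (auto simp: consistent_set.simps independent_set_def)
qed

text \<open>The bound \<open>c\<close> has to be uniform over all inputs satisfying
  \<open>P\<close>: it is built into the program through the size and number of the sets tried, and
  determines the degree of the polynomial.\<close>

lemma MCCEnum_if_caratheodory:
  assumes "\<And>X \<Sigma> E. mcc_instance (X, \<Sigma>, E) \<Longrightarrow> P X (closure_system X \<Sigma>) \<Longrightarrow>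
    caratheodory_number_le c X (closure_system X \<Sigma>)"
  shows "MCCEnum_in_incremental_polynomial_time P"
  unfolding MCCEnum_in_incremental_polynomial_time_def
proof (rule enumerable_if_new[OF polytime_new_solution[of "2 * c"]])
  let ?I = "{(X, \<Sigma>, E). mcc_instance (X, \<Sigma>, E) \<and> P X (closure_system X \<Sigma>)}"
  fix x :: "data mcc_input"
  assume x: "x \<in> ?I"
  obtain X \<Sigma> E where x': "x = (X, \<Sigma>, E)"
    by (cases x)
  have X: "finite X" and \<Sigma>: "implicational_base X \<Sigma>" and E: "simple_graph X E"
    and c: "caratheodory_number_le c X (closure_system X \<Sigma>)"
    using x assms[of X \<Sigma> E] unfolding x' by simp_all
  have sub: "maxCC (X, \<Sigma>, E) \<subseteq> Pow X"
    using maxCC_consistent[of _ X \<Sigma> E] by blast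
  show "finite (maxCC x)"
    unfolding x' by (rule finite_subset[OF sub]) (simp add: X)
  fix w
  assume w: "enc_instance w x"
  show "nodes F \<le> nodes w" if "y \<in> maxCC x" "enc_set (=) F y" for F y
  proof -
    have "distinct (list_of F)" "elems F \<subseteq> elems (left w)"
      using that sub enc_instance_dest(2)[OF w[unfolded x']] unfolding x' enc_set_eq by auto
    then have "nodes F \<le> nodes (left w)"
      by (rule nodes_distinct)
    then show ?thesis
      using nodes_left[of w] by (rule le_trans)
  qed
  show "new_solution (2 * c) w (data_of_list Fs) = Leaf \<and> set ys = maxCC x \<or>
      (\<exists>F. \<exists>y\<in>maxCC x - set ys. new_solution (2 * c) w (data_of_list Fs) = Branch F Leaf \<and>
        enc_set (=) F y)"
    if "list_all2 (enc_set (=)) Fs ys" "distinct ys" "set ys \<subseteq> maxCC x" for Fs ys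
    using that unfolding x'
    by (intro new_solution_correct[OF w[unfolded x'] X \<Sigma> consistent_set_local[OF c E]])
qed

theorem corollary2:
  shows "MCCEnum_in_incremental_polynomial_time (\<lambda>X \<F>. distributive \<F>) \<and>
    MCCEnum_in_incremental_polynomial_time poset_convexity \<and>
    MCCEnum_in_incremental_polynomial_time chordal_monophonic_convexity \<and>
    MCCEnum_in_incremental_polynomial_time (affine_convexity TYPE(real ^ 'k))"
proof (intro conjI)
  show "MCCEnum_in_incremental_polynomial_time (\<lambda>X \<F>. distributive \<F>)"
    by (rule MCCEnum_if_caratheodory[of _ 1]) (auto intro: caratheodory_distributive[simplified])
  show "MCCEnum_in_incremental_polynomial_time poset_convexity"
    by (rule MCCEnum_if_caratheodory[of _ 2]) (rule caratheodory_poset)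
  show "MCCEnum_in_incremental_polynomial_time chordal_monophonic_convexity"
    by (rule MCCEnum_if_caratheodory[of _ 2]) (rule caratheodory_chordal)
  show "MCCEnum_in_incremental_polynomial_time (affine_convexity TYPE(real ^ 'k))"
    by (rule MCCEnum_if_caratheodory[of _ "CARD('k) + 1"], rule caratheodory_affine)
      (auto simp: closure_system_def)
qed

end
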